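(* Consider the space--time SBP--SAT scheme on $K$ elements with zero source term: grid vectors $\boldsymbol u^{(1)},\dots,\boldsymbol u^{(K)}$ satisfying, for $1\le k\le K$, $$\big(\mathsf D_t^{(k)}-\kappa^{(k)}(\mathsf D_x^{(k)})^2\big)\boldsymbol u^{(k)}=-\mathsf S_w^{(k)}-\mathsf S_e^{(k)}-\mathsf S_0^{(k)}-\mathsf S_\Gamma^{(k,k-1)}-\mathsf S_\Gamma^{(k,k+1)},$$ where the operators, the element diffusivities $\kappa^{(k)}$, and the penalty (SAT) terms, depending on real coefficients $\sigma_0,\sigma_w,\sigma_e,\sigma_1,\sigma_2,\sigma_3,\sigma_4,\tau_1,\tau_2$ and on the boundary and initial data vectors $\boldsymbol h^{(1)},\boldsymbol g^{(K)},\boldsymbol q^{(k)}$, are those defined in the context. Let $\hat p_0=\boldsymbol e_w^{\mathsf T}\,\overline{\mathsf P}_x^{(1)}\boldsymbol e_w$ and $\hat p_{N_x}=\boldsymbol e_e^{\mathsf T}\,\overline{\mathsf P}_x^{(K)}\boldsymbol e_e$. Assume $$\sigma_0>\tfrac12,\qquad \sigma_w\ge\frac{\kappa_{\max}}{2\hat p_0},\qquad \sigma_e\ge\frac{\kappa_{\max}}{2\hat p_{N_x}},\qquad \sigma_1=\sigma_3\ge 0,$$ $$\sigma_2=s,\qquad \sigma_4=1+s,\qquad \tau_1=-(1+s),\qquad \tau_2=-s,$$ for some $s\in\mathbb R^+$ (any such $s$ is allowed). Then the scheme is stable, in the sense that the following energy estimate holds: $$\sum_{k=1}^K\big\|\mathsf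 R_n\boldsymbol u^{(k)}\big\|^2_{\overline{\mathsf P}_x^{(k)}}\le\frac{\sigma_0^2}{2\sigma_0-1}\sum_{k=1}^K\big\|\mathsf R_s\boldsymbol q^{(k)}\big\|^2_{\overline{\mathsf P}_x^{(k)}}+\sigma_w\big\|\mathsf R_w\boldsymbol h^{(1)}\big\|^2_{\overline{\mathsf P}_t}+\sigma_e\big\|\mathsf R_e\boldsymbol g^{(K)}\big\|^2_{\overline{\mathsf P}_t}.$$
   Context: **Domain and data.** The space--time domain $(a,b)\times(0,T)$, $a<b$, $T>0$, is partitioned into $K$ non-overlapping elements $\Omega_k=(a_k,b_k)\times(0,T)$, $k=1,\dots,K$, ordered from left to right ($a_1=a$, $b_k=a_{k+1}$, $b_K=b$). The scheme approximates $u_t=(\kappa u_x)_x+f$ (here $f=0$) with boundary data $u(a,t)=h(t)$, $u(b,t)=g(t)$ and initial data $u(x,0)=q(x)$. Each element has a constant diffusivity $\kappa^{(k)}=\kappa(\rho^{(k)})$ with $\rho^{(k)}\in[0,1]$ and $\kappa(\rho)=\kappa_{\min}+(\kappa_{\max}-\kappa_{\min})\rho^p$, where $0<\kappa_{\min}\le\kappa_{\max}$ and $p\ge1$ are constants; in particular $0<\kappa^{(k)}\le\kappa_{\max}$. **One-dimensional operators.** Let $N_x,N_t\ge1$. On $[a_k,b_k]$ take the $N_x+1$ Legendre--Gauss--Lobatto (LGL) nodes (endpoints included, increasing), and on $[0,T]$ the $N_t+1$ LGL nodes. Let $\overline{\mathsf D}_x^{(k)}$ and $\overline{\mathsf D}_t$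 be the corresponding pseudospectral (Lagrange interpolation) differentiation matrices and $\overline{\mathsf P}_x^{(k)}$, $\overline{\mathsf P}_t$ the diagonal positive definite matrices of LGL quadrature weights. These are summation-by-parts (SBP) operators: with $\overline{\mathsf Q}=\overline{\mathsf P}\,\overline{\mathsf D}$ (for each of the space and time operators), $\overline{\mathsf Q}+\overline{\mathsf Q}^{\mathsf T}=\mathrm{diag}(-1,0,\dots,0,1)$. **Space--time operators.** With $\mathsf I_x,\mathsf I_t$ the identity matrices of sizes $N_x+1$, $N_t+1$, set $\mathsf P^{(k)}=\overline{\mathsf P}_t\otimes\overline{\mathsf P}_x^{(k)}$, $\mathsf D_x^{(k)}=\mathsf I_t\otimes\overline{\mathsf D}_x^{(k)}$, $\mathsf D_t^{(k)}=\overline{\mathsf D}_t\otimes\mathsf I_x$. Vectors $\boldsymbol u^{(k)}\in\mathbb R^{(N_x+1)(N_t+1)}$ list nodal values on element $k$ with the spatial index running fastest. Let $\boldsymbol e_w=[1,0,\dots,0]^{\mathsf T}$, $\boldsymbol e_e=[0,\dots,0,1]^{\mathsf T}\in\mathbb R^{N_x+1}$ and $\boldsymbol e_s=[1,0,\dots,0]^{\mathsf T}$, $\boldsymbol e_n=[0,\dots,0,1]^{\mathsf T}\in\mathbb R^{N_t+1}$. The restrictions to the left (west), right (east), initial (south) and terminal (north) faces are $$\mathsf R_w=\mathsf I_t\otimes\boldsymbol e_w^{\mathsf T},\quad \mathsf R_e=\mathsf I_t\otimes\boldsymbol e_e^{\mathsf T},\quad \mathsf R_s=\boldsymbol e_s^{\mathsf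 T}\otimes\mathsf I_x,\quad \mathsf R_n=\boldsymbol e_n^{\mathsf T}\otimes\mathsf I_x.$$ For symmetric positive definite $M$, $\|\boldsymbol y\|_M^2=\boldsymbol y^{\mathsf T}M\boldsymbol y$. **Data vectors.** $\boldsymbol h^{(1)}$, $\boldsymbol g^{(K)}$, $\boldsymbol q^{(k)}$ contain the values of $h$, $g$, $q$ at the space--time grid points of elements $1$, $K$, $k$, respectively. **Boundary SATs.** $$\mathsf S_w^{(1)}=\sigma_w(\mathsf P^{(1)})^{-1}\mathsf R_w^{\mathsf T}\overline{\mathsf P}_t\big(\mathsf R_w\boldsymbol u^{(1)}-\mathsf R_w\boldsymbol h^{(1)}\big),\qquad \mathsf S_e^{(K)}=\sigma_e(\mathsf P^{(K)})^{-1}\mathsf R_e^{\mathsf T}\overline{\mathsf P}_t\big(\mathsf R_e\boldsymbol u^{(K)}-\mathsf R_e\boldsymbol g^{(K)}\big),$$ and $\mathsf S_w^{(k)}=0$ for $k\ne1$, $\mathsf S_e^{(k)}=0$ for $k\neq K$. **Initial SAT.** For $1\le k\le K$, $$\mathsf S_0^{(k)}=\sigma_0(\mathsf P^{(k)})^{-1}\mathsf R_s^{\mathsf T}\overline{\mathsf P}_x^{(k)}\big(\mathsf R_s\boldsymbol u^{(k)}-\mathsf R_s\boldsymbol q^{(k)}\big).$$ **Interface SATs.** For $2\le k\le K$, $$\begin{aligned}\mathsf S_\Gamma^{(k,k-1)}={}&\sigma_1(\mathsf P^{(k)})^{-1}\mathsf R_w^{\mathsf T}\overline{\mathsf P}_t\big(\mathsf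 R_w\boldsymbol u^{(k)}-\mathsf R_e\boldsymbol u^{(k-1)}\big)\\&+\sigma_2(\mathsf P^{(k)})^{-1}\mathsf R_w^{\mathsf T}\overline{\mathsf P}_t\big(\kappa^{(k)}\mathsf R_w\mathsf D_x^{(k)}\boldsymbol u^{(k)}-\kappa^{(k-1)}\mathsf R_e\mathsf D_x^{(k-1)}\boldsymbol u^{(k-1)}\big)\\&+\tau_1\kappa^{(k)}(\mathsf P^{(k)})^{-1}(\mathsf D_x^{(k)})^{\mathsf T}\mathsf R_w^{\mathsf T}\overline{\mathsf P}_t\big(\mathsf R_w\boldsymbol u^{(k)}-\mathsf R_e\boldsymbol u^{(k-1)}\big),\end{aligned}$$ and for $1\le k\le K-1$, $$\begin{aligned}\mathsf S_\Gamma^{(k,k+1)}={}&\sigma_3(\mathsf P^{(k)})^{-1}\mathsf R_e^{\mathsf T}\overline{\mathsf P}_t\big(\mathsf R_e\boldsymbol u^{(k)}-\mathsf R_w\boldsymbol u^{(k+1)}\big)\\&+\sigma_4(\mathsf P^{(k)})^{-1}\mathsf R_e^{\mathsf T}\overline{\mathsf P}_t\big(\kappa^{(k)}\mathsf R_e\mathsf D_x^{(k)}\boldsymbol u^{(k)}-\kappa^{(k+1)}\mathsf R_w\mathsf D_x^{(k+1)}\boldsymbol u^{(k+1)}\big)\\&+\tau_2\kappa^{(k)}(\mathsf P^{(k)})^{-1}(\mathsf D_x^{(k)})^{\mathsf T}\mathsf R_e^{\mathsf T}\overline{\mathsf P}_t\big(\mathsf R_e\boldsymbol u^{(k)}-\mathsf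 R_w\boldsymbol u^{(k+1)}\big),\end{aligned}$$ with $\mathsf S_\Gamma^{(1,0)}=0$ and $\mathsf S_\Gamma^{(K,K+1)}=0$. *)

theory Defs
  imports
    "HOL-Analysis.Henstock_Kurzweil_Integration"
    "HOL-Computational_Algebra.Polynomial"
    "Jordan_Normal_Form.Gauss_Jordan_Elimination"
begin

no_notation inner (infixl \<open>\<bullet>\<close> 70)

section \<open>Legendre--Gauss--Lobatto collocation on an interval\<close>

text \<open>Legendre polynomial, by the Rodrigues formula.\<close>
definition legendre :: "nat \<Rightarrow> real poly" where
  "legendre n =
     Polynomial.smult (1 / (2 ^ n * fact n)) ((pderiv ^^ n) ([:-1, 0, 1:] ^ n))"

text \<open>
  For \<open>N \<ge> 1\<close>, the \<open>N + 1\<close> LGL nodes on \<open>[-1, 1]\<close> are the zeros of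
  \<open>(1 - x^2) P_N'(x)\<close>, which include both endpoints; the list is increasing.
\<close>
definition ref_lgl_nodes :: "nat \<Rightarrow> real list" where
  "ref_lgl_nodes N =
     sorted_list_of_set {x. (1 - x\<^sup>2) * poly (pderiv (legendre N)) x = 0}"

definition lgl_nodes :: "nat \<Rightarrow> real \<Rightarrow> real \<Rightarrow> real list" where
  "lgl_nodes N l r = map (\<lambda>x. l + (r - l) / 2 * (x + 1)) (ref_lgl_nodes N)"

definition lagrange_basis :: "nat \<Rightarrow> real \<Rightarrow> real \<Rightarrow> nat \<Rightarrow> real poly" where
  "lagrange_basis N l r j =
     (let x = lgl_nodes N l r in
      \<Prod>m\<in>{..N} - {j}. Polynomial.smult (1 / (x ! j - x ! m)) [:- (x ! m), 1:])"

text \<open>Entry \<open>(i, j)\<close> is the derivative at node \<open>i\<close> of the \<open>j\<close>-th Lagrange polynomial.\<close>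
definition lgl_diff_mat :: "nat \<Rightarrow> real \<Rightarrow> real \<Rightarrow> real Matrix.mat" where
  "lgl_diff_mat N l r = Matrix.mat (N + 1) (N + 1)
     (\<lambda>(i, j). poly (pderiv (lagrange_basis N l r j)) (lgl_nodes N l r ! i))"

text \<open>The LGL rule is the interpolatory quadrature rule at the LGL nodes.\<close>
definition lgl_weight :: "nat \<Rightarrow> real \<Rightarrow> real \<Rightarrow> nat \<Rightarrow> real" where
  "lgl_weight N l r i = integral {l..r} (poly (lagrange_basis N l r i))"

definition lgl_weight_mat :: "nat \<Rightarrow> real \<Rightarrow> real \<Rightarrow> real Matrix.mat" where
  "lgl_weight_mat N l r = mat_diag (N + 1) (lgl_weight N l r)"


section \<open>Matrix notation\<close>

definition kron :: "real Matrix.mat \<Rightarrow> real Matrix.mat \<Rightarrow> real Matrix.mat" (infixr \<open>\<otimes>\<^sub>K\<close> 72) where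
  "A \<otimes>\<^sub>K B = Matrix.mat (dim_row A * dim_row B) (dim_col A * dim_col B)
     (\<lambda>(i, j). A $$ (i div dim_row B, j div dim_col B) * B $$ (i mod dim_row B, j mod dim_col B))"

definition row_mat :: "real Matrix.vec \<Rightarrow> real Matrix.mat" where
  "row_mat v = mat_of_rows (dim_vec v) [v]"

text \<open>Meaningful only for invertible \<open>A\<close>; otherwise \<open>mat_inverse A\<close> is \<open>None\<close>.\<close>
definition inv_mat :: "real Matrix.mat \<Rightarrow> real Matrix.mat" where
  "inv_mat A = the (mat_inverse A)"

definition weighted_norm_sq :: "real Matrix.mat \<Rightarrow> real Matrix.vec \<Rightarrow> real" where
  "weighted_norm_sq M y = y \<bullet> (M *\<^sub>v y)"


section \<open>The multi-element space--time scheme\<close>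

text \<open>
  Elements are numbered from \<open>1\<close> to \<open>num_elems\<close>; element \<open>k\<close> is
  \<open>(left_end k, right_end k) \<times> (0, final_time)\<close>.  The fields \<open>x_degree\<close> and
  \<open>t_degree\<close> are \<open>N\<^sub>x\<close> and \<open>N\<^sub>t\<close>, so there are one more nodes in each direction.
\<close>
record mesh =
  num_elems :: nat
  x_degree :: nat
  t_degree :: nat
  final_time :: real
  left_end :: "nat \<Rightarrow> real"
  right_end :: "nat \<Rightarrow> real"
  diffusivity :: "nat \<Rightarrow> real"

record sat_coeffs =
  sigma0 :: real
  sigma_w :: real
  sigma_e :: real
  sigma1 :: real
  sigma2 :: real
  sigma3 :: real
  sigma4 :: real
  tau1 :: real
  tau2 :: real

definition kappa_of :: "real \<Rightarrow> real \<Rightarrow> real \<Rightarrow> real \<Rightarrow> real" where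
  "kappa_of \<kappa>min \<kappa>max p \<rho> = \<kappa>min + (\<kappa>max - \<kappa>min) * \<rho> powr p"

definition num_dofs :: "mesh \<Rightarrow> nat" where
  "num_dofs M = (x_degree M + 1) * (t_degree M + 1)"

definition Px_bar :: "mesh \<Rightarrow> nat \<Rightarrow> real Matrix.mat" where
  "Px_bar M k = lgl_weight_mat (x_degree M) (left_end M k) (right_end M k)"

definition Dx_bar :: "mesh \<Rightarrow> nat \<Rightarrow> real Matrix.mat" where
  "Dx_bar M k = lgl_diff_mat (x_degree M) (left_end M k) (right_end M k)"

definition Pt_bar :: "mesh \<Rightarrow> real Matrix.mat" where
  "Pt_bar M = lgl_weight_mat (t_degree M) 0 (final_time M)"

definition Dt_bar :: "mesh \<Rightarrow> real Matrix.mat" where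
  "Dt_bar M = lgl_diff_mat (t_degree M) 0 (final_time M)"

definition I_x :: "mesh \<Rightarrow> real Matrix.mat" where
  "I_x M = 1\<^sub>m (x_degree M + 1)"

definition I_t :: "mesh \<Rightarrow> real Matrix.mat" where
  "I_t M = 1\<^sub>m (t_degree M + 1)"

definition e_w :: "mesh \<Rightarrow> real Matrix.vec" where
  "e_w M = unit_vec (x_degree M + 1) 0"

definition e_e :: "mesh \<Rightarrow> real Matrix.vec" where
  "e_e M = unit_vec (x_degree M + 1) (x_degree M)"

definition e_s :: "mesh \<Rightarrow> real Matrix.vec" where
  "e_s M = unit_vec (t_degree M + 1) 0"

definition e_n :: "mesh \<Rightarrow> real Matrix.vec" where
  "e_n M = unit_vec (t_degree M + 1) (t_degree M)"

definition P_st :: "mesh \<Rightarrow> nat \<Rightarrow> real Matrix.mat" where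
  "P_st M k = Pt_bar M \<otimes>\<^sub>K Px_bar M k"

definition D_x :: "mesh \<Rightarrow> nat \<Rightarrow> real Matrix.mat" where
  "D_x M k = I_t M \<otimes>\<^sub>K Dx_bar M k"

definition D_t :: "mesh \<Rightarrow> real Matrix.mat" where
  "D_t M = Dt_bar M \<otimes>\<^sub>K I_x M"

definition R_w :: "mesh \<Rightarrow> real Matrix.mat" where
  "R_w M = I_t M \<otimes>\<^sub>K row_mat (e_w M)"

definition R_e :: "mesh \<Rightarrow> real Matrix.mat" where
  "R_e M = I_t M \<otimes>\<^sub>K row_mat (e_e M)"

definition R_s :: "mesh \<Rightarrow> real Matrix.mat" where
  "R_s M = row_mat (e_s M) \<otimes>\<^sub>K I_x M"

definition R_n :: "mesh \<Rightarrow> real Matrix.mat" where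
  "R_n M = row_mat (e_n M) \<otimes>\<^sub>K I_x M"

text \<open>Values of \<open>f x t\<close> at the grid points of element \<open>k\<close>, spatial index fastest.\<close>
definition grid_vec :: "mesh \<Rightarrow> nat \<Rightarrow> (real \<Rightarrow> real \<Rightarrow> real) \<Rightarrow> real Matrix.vec" where
  "grid_vec M k f = Matrix.vec (num_dofs M)
     (\<lambda>i. f (lgl_nodes (x_degree M) (left_end M k) (right_end M k) ! (i mod (x_degree M + 1)))
            (lgl_nodes (t_degree M) 0 (final_time M) ! (i div (x_degree M + 1))))"

definition S_w ::
  "mesh \<Rightarrow> sat_coeffs \<Rightarrow> real Matrix.vec \<Rightarrow> (nat \<Rightarrow> real Matrix.vec) \<Rightarrow> nat \<Rightarrow> real Matrix.vec" where
  "S_w M c hv u k =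
     (if k = 1 then
        sigma_w c \<cdot>\<^sub>v ((inv_mat (P_st M k) * (R_w M)\<^sup>T * Pt_bar M) *\<^sub>v
          (R_w M *\<^sub>v u k - R_w M *\<^sub>v hv))
      else 0\<^sub>v (num_dofs M))"

definition S_e ::
  "mesh \<Rightarrow> sat_coeffs \<Rightarrow> real Matrix.vec \<Rightarrow> (nat \<Rightarrow> real Matrix.vec) \<Rightarrow> nat \<Rightarrow> real Matrix.vec" where
  "S_e M c gv u k =
     (if k = num_elems M then
        sigma_e c \<cdot>\<^sub>v ((inv_mat (P_st M k) * (R_e M)\<^sup>T * Pt_bar M) *\<^sub>v
          (R_e M *\<^sub>v u k - R_e M *\<^sub>v gv))
      else 0\<^sub>v (num_dofs M))"

definition S_0 ::
  "mesh \<Rightarrow> sat_coeffs \<Rightarrow> (nat \<Rightarrow> real Matrix.vec) \<Rightarrow> (nat \<Rightarrow> real Matrix.vec) \<Rightarrow> nat \<Rightarrow> real Matrix.vec" where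
  "S_0 M c qv u k =
     sigma0 c \<cdot>\<^sub>v ((inv_mat (P_st M k) * (R_s M)\<^sup>T * Px_bar M k) *\<^sub>v
       (R_s M *\<^sub>v u k - R_s M *\<^sub>v qv k))"

text \<open>Interface penalty on element \<open>k\<close> towards its left neighbour \<open>k - 1\<close>.\<close>
definition S_iface_left ::
  "mesh \<Rightarrow> sat_coeffs \<Rightarrow> (nat \<Rightarrow> real Matrix.vec) \<Rightarrow> nat \<Rightarrow> real Matrix.vec" where
  "S_iface_left M c u k =
     (if 2 \<le> k \<and> k \<le> num_elems M then
        sigma1 c \<cdot>\<^sub>v ((inv_mat (P_st M k) * (R_w M)\<^sup>T * Pt_bar M) *\<^sub>v
          (R_w M *\<^sub>v u k - R_e M *\<^sub>v u (k - 1)))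
      + sigma2 c \<cdot>\<^sub>v ((inv_mat (P_st M k) * (R_w M)\<^sup>T * Pt_bar M) *\<^sub>v
          (diffusivity M k \<cdot>\<^sub>v ((R_w M * D_x M k) *\<^sub>v u k)
           - diffusivity M (k - 1) \<cdot>\<^sub>v ((R_e M * D_x M (k - 1)) *\<^sub>v u (k - 1))))
      + (tau1 c * diffusivity M k) \<cdot>\<^sub>v
          ((inv_mat (P_st M k) * (D_x M k)\<^sup>T * (R_w M)\<^sup>T * Pt_bar M) *\<^sub>v
          (R_w M *\<^sub>v u k - R_e M *\<^sub>v u (k - 1)))
      else 0\<^sub>v (num_dofs M))"

text \<open>Interface penalty on element \<open>k\<close> towards its right neighbour \<open>k + 1\<close>.\<close>
definition S_iface_right ::
  "mesh \<Rightarrow> sat_coeffs \<Rightarrow> (nat \<Rightarrow> real Matrix.vec) \<Rightarrow> nat \<Rightarrow> real Matrix.vec" where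
  "S_iface_right M c u k =
     (if 1 \<le> k \<and> k + 1 \<le> num_elems M then
        sigma3 c \<cdot>\<^sub>v ((inv_mat (P_st M k) * (R_e M)\<^sup>T * Pt_bar M) *\<^sub>v
          (R_e M *\<^sub>v u k - R_w M *\<^sub>v u (k + 1)))
      + sigma4 c \<cdot>\<^sub>v ((inv_mat (P_st M k) * (R_e M)\<^sup>T * Pt_bar M) *\<^sub>v
          (diffusivity M k \<cdot>\<^sub>v ((R_e M * D_x M k) *\<^sub>v u k)
           - diffusivity M (k + 1) \<cdot>\<^sub>v ((R_w M * D_x M (k + 1)) *\<^sub>v u (k + 1))))
      + (tau2 c * diffusivity M k) \<cdot>\<^sub>v
          ((inv_mat (P_st M k) * (D_x M k)\<^sup>T * (R_e M)\<^sup>T * Pt_bar M) *\<^sub>v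
          (R_e M *\<^sub>v u k - R_w M *\<^sub>v u (k + 1)))
      else 0\<^sub>v (num_dofs M))"

text \<open>The homogeneous scheme, with data vectors \<open>hv\<close>, \<open>gv\<close> and \<open>qv k\<close>.\<close>
definition solves_scheme ::
  "mesh \<Rightarrow> sat_coeffs \<Rightarrow> real Matrix.vec \<Rightarrow> real Matrix.vec \<Rightarrow> (nat \<Rightarrow> real Matrix.vec)
     \<Rightarrow> (nat \<Rightarrow> real Matrix.vec) \<Rightarrow> bool" where
  "solves_scheme M c hv gv qv u \<longleftrightarrow>
     (\<forall>k\<in>{1..num_elems M}.
        u k \<in> carrier_vec (num_dofs M) \<and>
        (D_t M - diffusivity M k \<cdot>\<^sub>m (D_x M k ^\<^sub>m 2)) *\<^sub>v u k =
          - S_w M c hv u k - S_e M c gv u k - S_0 M c qv u k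
          - S_iface_left M c u k - S_iface_right M c u k)"

end

theory Submission
  imports Defs
begin

text \<open>
  The energy method. Legendre orthogonality makes the Lobatto rule with \<open>N + 1\<close> nodes exact up to
  degree \<open>2 * N - 1\<close>; hence its weights are positive and the collocation derivative satisfies
  summation by parts. Testing the scheme on an element with \<open>P u\<close> therefore leaves only face terms
  and the dissipation \<open>\<kappa> \<parallel>D\<^sub>x u\<parallel>\<^sup>2\<close>. At an interface all flux terms of the two neighbours cancel for
  the given coefficients, leaving \<open>sigma1\<close> times the squared jump. At the outer boundaries the
  flux is absorbed by the part of the dissipation carried by the boundary node, and at the
  initial face a square is completed.
\<close>

section \<open>Integrals of polynomials\<close>

text \<open>The collocation data are concrete, so their properties have to be earned: the node list
  sorts a set of zeros whose size must be established before indexing into it means anything, and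
  the weights are integrals whose sign is not visible. Counting zeros by Rolle's theorem settles the
  first point, exactness of the rule the second. Degree \<open>2 * N - 1\<close> is just what
  summation by parts consumes, since it is the largest degree of the derivative of a product of two
  interpolants of degree at most \<open>N\<close>.

  The dissipation has to be shared with care. With a single element both outer boundaries draw on
  the same \<open>D_x u\<close>, so their reserves must come from disjoint terms of its norm; the
  first and last spatial nodes differ because \<open>x_degree M\<close> is at least 1. Each reserve
  carries the quadrature weight of its node, which is how these weights enter the thresholds for
  \<open>sigma_w\<close> and \<open>sigma_e\<close>. The bound \<open>\<kappa>max\<close> stands
  there for the diffusivity of the boundary element.\<close>

lemma poly_antiderivative:
  fixes p :: "real poly"
  obtains P where "pderiv P = p"
proof
  let ?P = "\<Sum>i\<le>degree p. monom (coeff p i / real (Suc i)) (Suc i)"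
  have "pderiv ?P = (\<Sum>i\<le>degree p. monom (coeff p i) i)"
    by (simp add: higher_pderiv_sum[of 1, simplified] pderiv_monom del: of_nat_Suc)
  then show "pderiv ?P = p"
    by (simp add: poly_as_sum_of_monoms)
qed

lemma poly_integrable_on [simp]: "poly (p :: real poly) integrable_on {l..r}"
  by (intro integrable_continuous_real continuous_intros)

lemma integral_poly_pderiv:
  fixes p :: "real poly"
  assumes "l \<le> r"
  shows "integral {l..r} (poly (pderiv p)) = poly p r - poly p l"
proof (intro integral_unique fundamental_theorem_of_calculus assms)
  show "(poly p has_vector_derivative poly (pderiv p) x) (at x within {l..r})" for x
    using poly_DERIV has_field_derivative_at_within has_real_derivative_iff_has_vector_derivative
    by blast
qed

lemma integral_poly_add:
  "integral {l..r} (poly (p + q)) = integral {l..r} (poly p) + integral {l..r} (poly (q :: real poly))"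
  by (simp add: integral_add poly_add[abs_def])

lemma integral_poly_smult:
  "integral {l..r} (poly (Polynomial.smult c p)) = c * integral {l..r} (poly (p :: real poly))"
  by (simp add: poly_smult[abs_def])

lemma integral_poly_sum:
  assumes "finite A"
  shows "integral {l..r} (poly (\<Sum>i\<in>A. f i)) = (\<Sum>i\<in>A. integral {l..r} (poly (f i :: real poly)))"
  using assms by (induction A rule: finite_induct) (simp_all add: integral_poly_add poly_0[abs_def] del: poly_add)

lemma integral_poly_by_parts:
  fixes p q :: "real poly"
  assumes "l \<le> r"
  shows "integral {l..r} (poly (pderiv p * q)) =
    poly p r * poly q r - poly p l * poly q l - integral {l..r} (poly (p * pderiv q))"
  using integral_poly_pderiv[OF assms, of "p * q"]
  by (simp add: pderiv_mult integral_poly_add mult.commute)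

text \<open>An antiderivative is nondecreasing on the interval. If its total increase were zero it
  would be constant there, hence equal to a constant polynomial by having infinitely many
  coincidences, and \<open>p\<close> would vanish identically.\<close>

lemma integral_poly_pos:
  fixes p :: "real poly"
  assumes "l < r" and nonneg: "\<And>x. l \<le> x \<Longrightarrow> x \<le> r \<Longrightarrow> poly p x \<ge> 0"
    and "p \<noteq> 0"
  shows "integral {l..r} (poly p) > 0"
proof -
  obtain P where P: "pderiv P = p" by (rule poly_antiderivative)
  have mono: "poly P x \<le> poly P y" if "l \<le> x" "x \<le> y" "y \<le> r" for x y
    by (rule DERIV_nonneg_imp_nondecreasing[OF that(2)]) (use P nonneg that in \<open>auto intro!: exI poly_DERIV\<close>)
  have "poly P l \<noteq> poly P r"
  proof
    assume eq: "poly P l = poly P r"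
    have "poly (P - [:poly P l:]) x = 0" if "x \<in> {l..r}" for x
      using that mono[of l x] mono[of x r] eq by auto
    then have "{l..r} \<subseteq> {x. poly (P - [:poly P l:]) x = 0}" by blast
    moreover have "infinite {l..r}" using \<open>l < r\<close> by (simp add: infinite_Icc)
    ultimately have "P - [:poly P l:] = 0"
      using poly_roots_finite finite_subset by blast
    then have "pderiv P = 0"
      by (metis eq_iff_diff_eq_0 pderiv_singleton)
    then show False using P \<open>p \<noteq> 0\<close> by simp
  qed
  then show ?thesis
    using integral_poly_pderiv[of l r P] mono[of l r] P \<open>l < r\<close> by simp
qed

text \<open>Substitution done on an antiderivative: composing it with the affine map multiplies its
  derivative by the slope. The coefficient list is the map \<open>y\<close> to
  \<open>l + (r - l) / 2 * (y + 1)\<close> that also defines \<open>lgl_nodes\<close>.\<close>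

lemma integral_poly_affine:
  fixes p :: "real poly"
  assumes "l \<le> r"
  shows "integral {l..r} (poly p)
    = (r - l) / 2 * integral {-1..1} (poly (p \<circ>\<^sub>p [:l + (r - l) / 2, (r - l) / 2:]))"
proof -
  obtain P where P: "pderiv P = p" by (rule poly_antiderivative)
  let ?\<phi> = "[:l + (r - l) / 2, (r - l) / 2:]"
  have "pderiv (P \<circ>\<^sub>p ?\<phi>) = Polynomial.smult ((r - l) / 2) (p \<circ>\<^sub>p ?\<phi>)"
    by (simp add: pderiv_pcompose P pderiv_pCons)
  moreover have "l + (r - l) / 2 + (r - l) / 2 = r" "l + (r - l) / 2 - (r - l) / 2 = l"
    by (simp_all add: field_simps)
  ultimately have "(r - l) / 2 * integral {-1..1} (poly (p \<circ>\<^sub>p ?\<phi>)) = poly P r - poly P l"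
    using integral_poly_pderiv[of "-1" 1 "P \<circ>\<^sub>p ?\<phi>"]
    by (simp add: integral_poly_smult poly_pcompose minus_divide_left[symmetric] del: minus_diff_eq)
  then show ?thesis
    using integral_poly_pderiv[OF assms, of P] P by simp
qed

section \<open>Lobatto quadrature\<close>

text \<open>Adding points in increasing order makes distinctness easy: the new zero of the
  derivative lies beyond \<open>Max S\<close>, whereas all earlier ones lie below it. The two
  existential bounds record this and later keep zeros strictly inside
  \<open>(-1, 1)\<close>.\<close>

lemma rolle_poly_roots:
  fixes p :: "real poly"
  assumes "finite S" "\<And>x. x \<in> S \<Longrightarrow> poly p x = 0"
  shows "\<exists>R. finite R \<and> card R = card S - 1 \<and>
    (\<forall>x\<in>R. poly (pderiv p) x = 0 \<and> (\<exists>a\<in>S. a < x) \<and> (\<exists>b\<in>S. x < b))"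
  using assms
proof (induction S rule: finite_linorder_max_induct)
  case empty
  then show ?case by (intro exI[of _ "{}"]) simp
next
  case (insert m S)
  show ?case
  proof (cases "S = {}")
    case True
    then show ?thesis by (intro exI[of _ "{}"]) simp
  next
    case False
    obtain R where R: "finite R" "card R = card S - 1"
      "\<forall>x\<in>R. poly (pderiv p) x = 0 \<and> (\<exists>a\<in>S. a < x) \<and> (\<exists>b\<in>S. x < b)"
      using insert by auto
    have M: "Max S \<in> S" "\<And>x. x \<in> S \<Longrightarrow> x \<le> Max S" using False insert(1) by auto
    have "Max S < m" using M insert(2) by auto
    then obtain z where z: "Max S < z" "z < m" "poly p m - poly p (Max S) = (m - Max S) * poly (pderiv p) z"
      using poly_MVT by blast
    have root: "poly (pderiv p) z = 0"
      using z(3) \<open>Max S < m\<close> insert(4) M(1) by simp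
    have "z \<notin> R" using R(3) M(2) z(1) by force
    moreover have "card S \<ge> 1" "m \<notin> S" using False insert(1,2) by (auto simp: Suc_le_eq card_gt_0_iff)
    ultimately show ?thesis
      using R root z M(1) insert(1)
      by (intro exI[of _ "insert z R"]) auto
  qed
qed

text \<open>Differentiation lowers the multiplicity of a zero by at most one: both summands of the
  product rule keep all but one of the linear factors. For \<open>i\<close> beyond \<open>n\<close>
  the truncated exponent is 0.\<close>

lemma linear_power_dvd_higher_pderiv:
  fixes p :: "real poly"
  assumes "[:-a, 1:] ^ n dvd p"
  shows "[:-a, 1:] ^ (n - i) dvd (pderiv ^^ i) p"
proof (induction i)
  case 0
  show ?case using assms by simp
next
  case (Suc i)
  show ?case
  proof (cases "n - i")
    case 0
    then show ?thesis by simp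
  next
    case (Suc m)
    then obtain q where q: "(pderiv ^^ i) p = [:-a, 1:] ^ Suc m * q"
      using Suc.IH by (metis dvdE)
    have "[:-a, 1:] ^ m dvd pderiv ([:-a, 1:] ^ Suc m * q)"
      unfolding pderiv_mult pderiv_power_Suc
      by (intro dvd_add dvd_mult2[OF le_imp_power_dvd] dvd_mult[OF dvd_mult2] dvd_smult) simp_all
    moreover have "n - Suc i = m" using Suc by simp
    ultimately show ?thesis using q by simp
  qed
qed

section \<open>Rodrigues' formula: orthogonality and zeros of Legendre polynomials\<close>

context
  fixes N :: nat and w :: "real poly"
  assumes w_def: "w = [:-1, 0, 1:] ^ N"
begin

lemma rodrigues_higher_pderiv_zero:
  assumes "i < N" "x = 1 \<or> x = -1"
  shows "poly ((pderiv ^^ i) w) x = 0"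
proof -
  have "w = [:-1, 1:] ^ N * [:-(-1), 1:] ^ N"
    by (simp add: w_def flip: power_mult_distrib)
  then have "[:-x, 1:] ^ N dvd w"
    using assms(2) by (metis dvd_triv_left dvd_triv_right)
  then have "[:-x, 1:] ^ (N - i) dvd (pderiv ^^ i) w"
    by (rule linear_power_dvd_higher_pderiv)
  moreover have "[:-x, 1:] dvd [:-x, 1:] ^ (N - i)"
    using assms(1) by (intro dvd_power) simp
  ultimately show ?thesis
    by (metis dvd_trans poly_eq_0_iff_dvd)
qed

text \<open>Each integration by parts moves one derivative from \<open>w\<close> to
  \<open>q\<close>; the boundary terms vanish because \<open>w\<close> has zeros of order
  \<open>N\<close> at both endpoints. Allowing every \<open>j\<close> up to \<open>N\<close> is what
  makes the induction possible.\<close>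

lemma rodrigues_orthogonal:
  assumes "j \<le> N" "degree q < j"
  shows "integral {-1..1} (poly ((pderiv ^^ j) w * q)) = 0"
  using assms
proof (induction j arbitrary: q)
  case 0
  then show ?case by simp
next
  case (Suc j)
  have "integral {-1..1} (poly ((pderiv ^^ Suc j) w * q)) =
      - integral {-1..1} (poly ((pderiv ^^ j) w * pderiv q))"
    using integral_poly_by_parts[of "-1" 1 "(pderiv ^^ j) w" q] Suc.prems
    by (simp add: rodrigues_higher_pderiv_zero)
  also have "integral {-1..1} (poly ((pderiv ^^ j) w * pderiv q)) = 0"
  \<comment> \<open>A constant cannot lose a degree under truncated subtraction, so the induction
    hypothesis does not apply to it; its derivative is zero instead.\<close>
  proof (cases "degree q = 0")
    case True
    then have "pderiv q = 0" by (simp add: pderiv_eq_0_iff)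
    then show ?thesis by (simp add: poly_0[abs_def])
  next
    case False
    then show ?thesis using Suc by (intro Suc.IH) (auto simp: degree_pderiv)
  qed
  finally show ?case by simp
qed

text \<open>For \<open>i\<close> below \<open>N\<close> the endpoints are zeros as well, so
  \<open>i\<close> interior zeros amount to \<open>i + 2\<close> zeros in all, and Rolle yields
  \<open>i + 1\<close> interior zeros of the next derivative.\<close>

lemma rodrigues_roots:
  assumes "i \<le> N"
  shows "\<exists>S. finite S \<and> card S = i \<and> S \<subseteq> {-1<..<1} \<and> (\<forall>x\<in>S. poly ((pderiv ^^ i) w) x = 0)"
  using assms
proof (induction i)
  case 0
  show ?case by (intro exI[of _ "{}"]) simp
next
  case (Suc i)
  then obtain S where S: "finite S" "card S = i" "S \<subseteq> {-1<..<1}"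
    "\<forall>x\<in>S. poly ((pderiv ^^ i) w) x = 0" by auto
  define S' where "S' = insert (-1) (insert 1 S)"
  have S': "finite S'" "card S' = i + 2" "\<And>x. x \<in> S' \<Longrightarrow> -1 \<le> x \<and> x \<le> 1"
    using S by (force simp: S'_def card_insert_if)+
  have "poly ((pderiv ^^ i) w) x = 0" if "x \<in> S'" for x
    using that S(4) Suc.prems rodrigues_higher_pderiv_zero[of i x] by (auto simp: S'_def)
  from rolle_poly_roots[OF S'(1) this] obtain R where
    "finite R" "card R = Suc i" and
    R: "\<forall>x\<in>R. poly (pderiv ((pderiv ^^ i) w)) x = 0 \<and> (\<exists>a\<in>S'. a < x) \<and> (\<exists>b\<in>S'. x < b)"
    using S'(2) by auto
  moreover have "R \<subseteq> {-1<..<1}" using R S'(3) by force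
  ultimately show ?case by (intro exI[of _ R]) simp
qed

end

lemma legendre_orthogonal:
  assumes "degree q < N"
  shows "integral {-1..1} (poly (legendre N * q)) = 0"
  using rodrigues_orthogonal[OF refl order_refl assms]
  by (simp add: legendre_def integral_poly_smult)

text \<open>The factor \<open>[:1, 0, -1:]\<close> is \<open>1 - x^2\<close>. It removes the
  boundary terms when the derivative is shifted off \<open>legendre N\<close>, and the derivative of
  \<open>(1 - x^2) * q\<close> still has degree below \<open>N\<close>.\<close>

lemma legendre_deriv_orthogonal:
  assumes "degree q + 2 \<le> N"
  shows "integral {-1..1} (poly ([:1, 0, -1:] * pderiv (legendre N) * q)) = 0"
proof -
  have "degree ([:1, 0, -1:] * q) \<le> degree q + 2"
    by (rule order_trans[OF degree_mult_le]) simp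
  then have "degree (pderiv ([:1, 0, -1:] * q)) < N"
    using assms by (simp add: degree_pderiv)
  then have "integral {-1..1} (poly (legendre N * pderiv ([:1, 0, -1:] * q))) = 0"
    by (rule legendre_orthogonal)
  then have "integral {-1..1} (poly (pderiv (legendre N) * ([:1, 0, -1:] * q))) = 0"
    by (subst integral_poly_by_parts) simp_all
  then show ?thesis by (simp only: mult_ac)
qed

lemma degree_legendre: "degree (legendre N) = N"
  by (simp add: legendre_def degree_higher_pderiv degree_power_eq)

lemma legendre_deriv_roots:
  assumes "N \<ge> 1"
  obtains S where "finite S" "card S = N - 1" "S \<subseteq> {-1<..<1}"
    "\<forall>x\<in>S. poly (pderiv (legendre N)) x = 0"
proof -
  obtain S where S: "finite S" "card S = N" "S \<subseteq> {-1<..<1}" "\<forall>x\<in>S. poly (legendre N) x = 0"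
    using rodrigues_roots[OF refl order_refl] by (force simp: legendre_def)
  obtain R where R: "finite R" "card R = card S - 1"
    "\<forall>x\<in>R. poly (pderiv (legendre N)) x = 0 \<and> (\<exists>a\<in>S. a < x) \<and> (\<exists>b\<in>S. x < b)"
    using rolle_poly_roots[OF S(1)] S(4) by blast
  moreover have "R \<subseteq> {-1<..<1}" using R(3) S(3) by force
  ultimately show ?thesis using S(2) by (intro that[of R]) auto
qed

section \<open>Quadrature and differentiation on abstract Lobatto nodes\<close>

text \<open>The locale isolates what the quadrature argument uses, in a form invariant under affine
  maps, so that it transfers from \<open>[-1, 1]\<close> to any interval. Writing
  \<open>degree q + 2\<close> avoids truncated subtraction; for \<open>N = 1\<close> the
  orthogonality condition is vacuous.\<close>

locale lobatto_rule =
  fixes N :: nat and x :: "nat \<Rightarrow> real"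
  assumes N_pos: "N \<ge> 1"
    and nodes_strict_mono: "\<And>i j. i < j \<Longrightarrow> j \<le> N \<Longrightarrow> x i < x j"
    and node_poly_orthogonal: "\<And>q. degree q + 2 \<le> N \<Longrightarrow>
      integral {x 0..x N} (poly ((\<Prod>m\<le>N. [:- x m, 1:]) * q)) = 0"
begin

definition basis :: "nat \<Rightarrow> real poly" where
  "basis j = (\<Prod>m\<in>{..N} - {j}. Polynomial.smult (1 / (x j - x m)) [:- x m, 1:])"

definition weight :: "nat \<Rightarrow> real" where
  "weight j = integral {x 0..x N} (poly (basis j))"

definition interp :: "(nat \<Rightarrow> real) \<Rightarrow> real poly" where
  "interp v = (\<Sum>j\<le>N. Polynomial.smult (v j) (basis j))"

definition diff :: "(nat \<Rightarrow> real) \<Rightarrow> nat \<Rightarrow> real" where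
  "diff v i = (\<Sum>j\<le>N. poly (pderiv (basis j)) (x i) * v j)"

lemma ends_less: "x 0 < x N"
  using nodes_strict_mono[of 0 N] N_pos by simp

lemma nodes_eq_iff: "i \<le> N \<Longrightarrow> j \<le> N \<Longrightarrow> x i = x j \<longleftrightarrow> i = j"
  using nodes_strict_mono[of i j] nodes_strict_mono[of j i] by (cases i j rule: linorder_cases) auto

lemma card_nodes: "card (x ` {..N}) = Suc N"
  by (subst card_image) (auto simp: inj_on_def nodes_eq_iff)

lemma poly_basis_node:
  assumes "i \<le> N" "j \<le> N"
  shows "poly (basis j) (x i) = (if i = j then 1 else 0)"
proof (cases "i = j")
  case True
  have "poly (Polynomial.smult (1 / (x j - x m)) [:- x m, 1:]) (x j) = 1" if "m \<in> {..N} - {j}" for m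
    using that assms nodes_eq_iff[of j m] by (simp flip: diff_divide_distrib)
  then show ?thesis
    using True by (simp add: basis_def poly_prod)
next
  case False
  then show ?thesis
    using assms by (auto simp: basis_def poly_prod intro!: bexI[of _ i])
qed

lemma degree_basis:
  assumes "j \<le> N"
  shows "degree (basis j) \<le> N"
proof -
  have deg: "degree (Polynomial.smult c [:- a, 1:]) \<le> 1" for a c :: real
    by (rule order_trans[OF degree_smult_le]) simp
  have "degree (basis j) \<le> (\<Sum>m\<in>{..N} - {j}. degree (Polynomial.smult (1 / (x j - x m)) [:- x m, 1:]))"
    using degree_prod_sum_le[of "{..N} - {j}"] by (simp add: basis_def comp_def del: smult_pCons degree_smult_eq)
  also have "\<dots> \<le> (\<Sum>m\<in>{..N} - {j}. 1)"
    by (intro sum_mono deg)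
  finally have "degree (basis j) \<le> (\<Sum>m\<in>{..N} - {j}. 1)" .
  then show ?thesis using assms by simp
qed

lemma degree_interp: "degree (interp v) \<le> N"
  unfolding interp_def
  by (intro degree_sum_le) (auto intro: order_trans[OF degree_smult_le] degree_basis)

lemma poly_interp_node:
  assumes "i \<le> N"
  shows "poly (interp v) (x i) = v i"
proof -
  have "poly (interp v) (x i) = (\<Sum>j\<le>N. if j = i then v j else 0)"
    unfolding interp_def poly_sum using assms by (intro sum.cong) (auto simp: poly_basis_node)
  then show ?thesis using assms by simp
qed

lemma interp_poly:
  assumes "degree f \<le> N"
  shows "interp (\<lambda>j. poly f (x j)) = f"
proof (rule poly_eqI_degree[where A = "x ` {..N}"])
  show "degree (interp (\<lambda>j. poly f (x j))) < card (x ` {..N})"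
    using degree_interp[of "\<lambda>j. poly f (x j)"] by (simp add: card_nodes)
qed (use assms in \<open>auto simp: card_nodes poly_interp_node\<close>)

lemma integral_interp: "integral {x 0..x N} (poly (interp v)) = (\<Sum>j\<le>N. weight j * v j)"
  by (simp add: interp_def integral_poly_sum integral_poly_smult weight_def mult.commute)

text \<open>Gauss's division argument: write \<open>f\<close> as node polynomial times
  \<open>q\<close> plus \<open>g\<close>. The first part vanishes at the nodes and integrates to
  zero by orthogonality; the remainder has degree at most \<open>N\<close> and equals its own
  interpolant.\<close>

theorem quadrature_exact:
  assumes "degree f < 2 * N"
  shows "integral {x 0..x N} (poly f) = (\<Sum>j\<le>N. weight j * poly f (x j))"
proof -
  let ?\<omega> = "\<Prod>m\<le>N. [:- x m, 1:]"
  have nz: "?\<omega> \<noteq> 0" by simp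
  have deg: "degree ?\<omega> = Suc N" by (subst degree_prod_sum_eq) auto
  define q where "q = f div ?\<omega>"
  define g where "g = f mod ?\<omega>"
  have f: "f = ?\<omega> * q + g" by (simp add: q_def g_def)
  have deg_g: "degree g \<le> N"
    using degree_mod_less[OF nz, of f] deg by (auto simp: g_def)
  have "integral {x 0..x N} (poly (?\<omega> * q)) = 0"
  proof (cases "q = 0")
    case True
    then show ?thesis by (simp add: poly_0[abs_def])
  next
    case False
    have "degree (?\<omega> * q) = Suc N + degree q"
      using degree_mult_eq[OF nz False] deg by simp
    \<comment> \<open>The product is \<open>f - g\<close>. As its degree
      \<open>Suc N + degree q\<close> exceeds \<open>degree g\<close>, it is at most
      \<open>degree f\<close>, hence below \<open>2 * N\<close>; this leaves
      \<open>degree q + 2 \<le> N\<close>.\<close>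
    moreover have "degree (?\<omega> * q) \<le> max (degree f) (degree g)"
      using degree_diff_le_max[of f g] f by simp
    ultimately show ?thesis
      using assms deg_g by (intro node_poly_orthogonal) auto
  qed
  moreover have "poly f (x j) = poly g (x j)" if "j \<le> N" for j
    using that by (subst f) (auto simp: poly_prod)
  moreover have "integral {x 0..x N} (poly g) = (\<Sum>j\<le>N. weight j * poly g (x j))"
    using integral_interp[of "\<lambda>j. poly g (x j)"] interp_poly[OF deg_g] by simp
  ultimately show ?thesis
    by (subst f) (simp add: integral_poly_add)
qed

text \<open>
  The test polynomial vanishes at every node but \<open>x i\<close>; squaring only the factors of the
  interior nodes keeps its degree below \<open>2 * N\<close>, where the rule is exact.
\<close>
lemma weight_pos:
  assumes i: "i \<le> N"
  shows "weight i > 0"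
proof -
  define g where "g = (\<Prod>m\<in>{1..<N} - {i}. [:- x m, 1:])"
  define lf where "lf = (if i = 0 then 1 else [:- x 0, 1:])"
  \<comment> \<open>The sign is chosen so that both unsquared end factors are nonnegative between
    the end nodes.\<close>
  define rf where "rf = (if i = N then 1 else [:x N, -1:])"
  define f where "f = g ^ 2 * (lf * rf)"
  have pg: "poly g y = (\<Prod>m\<in>{1..<N} - {i}. y - x m)" for y
    by (simp add: g_def poly_prod)
  have "degree g = card ({1..<N} - {i})"
    unfolding g_def by (subst degree_prod_sum_eq) auto
  then have "degree f \<le> 2 * card ({1..<N} - {i}) + (degree lf + degree rf)"
    unfolding f_def
    by (intro order_trans[OF degree_mult_le] add_mono order_trans[OF degree_power_le]) (auto simp: degree_mult_le)
  \<comment> \<open>At an end node there are \<open>N - 1\<close> squared factors and one linear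
    factor, giving \<open>2 * N - 1\<close>; at an interior node \<open>N - 2\<close> squared and
    two linear factors give \<open>2 * N - 2\<close>.\<close>
  also have "\<dots> < 2 * N"
  proof (cases "i = 0 \<or> i = N")
    case True
    then show ?thesis using N_pos by (auto simp: lf_def rf_def)
  next
    case False
    then show ?thesis using i by (auto simp: lf_def rf_def card_Diff_singleton)
  qed
  finally have exact: "integral {x 0..x N} (poly f) = (\<Sum>j\<le>N. weight j * poly f (x j))"
    by (rule quadrature_exact)
  have vanish: "poly f (x j) = 0" if "j \<le> N" "j \<noteq> i" for j
  proof -
    consider "j = 0" | "j = N" | "j \<in> {1..<N} - {i}" using \<open>j \<le> N\<close> \<open>j \<noteq> i\<close> by force
    then show ?thesis
    proof cases
      case 3
      then have "poly g (x j) = 0" by (auto simp: pg)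
      then show ?thesis by (simp add: f_def)
    qed (use \<open>j \<noteq> i\<close> in \<open>auto simp: f_def lf_def rf_def\<close>)
  qed
  have "poly lf (x i) > 0" "poly rf (x i) > 0"
    using i nodes_strict_mono[of 0 i] nodes_strict_mono[of i N] by (auto simp: lf_def rf_def)
  moreover have "poly g (x i) \<noteq> 0"
    using i by (auto simp: pg nodes_eq_iff)
  ultimately have pos: "poly f (x i) > 0" by (simp add: f_def)
  have "integral {x 0..x N} (poly f) > 0"
  proof (rule integral_poly_pos[OF ends_less])
    show "poly f y \<ge> 0" if "x 0 \<le> y" "y \<le> x N" for y
      using that by (auto simp: f_def lf_def rf_def)
    show "f \<noteq> 0" using pos by auto
  qed
  also have "integral {x 0..x N} (poly f) = weight i * poly f (x i)"
  proof -
    have "(\<Sum>j\<le>N. weight j * poly f (x j)) = (\<Sum>j\<le>N. if j = i then weight i * poly f (x i) else 0)"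
      by (intro sum.cong) (auto simp: vanish)
    then show ?thesis using exact i by simp
  qed
  finally show ?thesis using pos by (simp add: zero_less_mult_iff)
qed

lemma diff_eq: "diff v i = poly (pderiv (interp v)) (x i)"
  by (simp add: diff_def interp_def higher_pderiv_sum[of 1, simplified] pderiv_smult poly_sum mult.commute)

text \<open>Both sides express the integral of the derivative of the product of the two
  interpolants: by the rule, which is exact for it, and by the fundamental theorem.\<close>

theorem summation_by_parts:
  "(\<Sum>i\<le>N. weight i * (v i * diff z i)) + (\<Sum>i\<le>N. weight i * (diff v i * z i))
    = v N * z N - v 0 * z 0"
proof -
  let ?V = "interp v" and ?Z = "interp z"
  have "degree (?V * ?Z) \<le> N + N"
    by (intro order_trans[OF degree_mult_le] add_mono degree_interp)
  then have "degree (pderiv (?V * ?Z)) < 2 * N"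
    using N_pos by (simp add: degree_pderiv)
  then have "poly (?V * ?Z) (x N) - poly (?V * ?Z) (x 0)
      = (\<Sum>i\<le>N. weight i * poly (pderiv (?V * ?Z)) (x i))"
    using quadrature_exact[of "pderiv (?V * ?Z)"] integral_poly_pderiv[of "x 0" "x N" "?V * ?Z"]
      ends_less by simp
  also have "\<dots> = (\<Sum>i\<le>N. weight i * (v i * diff z i + diff v i * z i))"
    by (intro sum.cong) (auto simp: pderiv_mult poly_interp_node diff_eq mult.commute)
  finally show ?thesis
    by (simp add: poly_interp_node distrib_left sum.distrib)
qed

end

section \<open>The Legendre--Gauss--Lobatto nodes form such a rule\<close>

text \<open>The \<open>N - 1\<close> interior zeros and the two endpoints already exhaust the degree
  \<open>N + 1\<close> of \<open>(1 - x^2) * P_N'\<close>, so the sorted set is exactly these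
  points. The node polynomial is then a multiple of that polynomial and inherits its
  orthogonality.\<close>

lemma ref_lgl_nodes_rule:
  assumes "N \<ge> 1"
  shows "lobatto_rule N ((!) (ref_lgl_nodes N))" "ref_lgl_nodes N ! 0 = -1" "ref_lgl_nodes N ! N = 1"
    "length (ref_lgl_nodes N) = Suc N"
proof -
  define \<omega> where "\<omega> = [:1, 0, -1:] * pderiv (legendre N)"
  obtain S where S: "finite S" "card S = N - 1" "S \<subseteq> {-1<..<1}"
    "\<forall>x\<in>S. poly (pderiv (legendre N)) x = 0"
    using legendre_deriv_roots[OF assms] .
  define Z where "Z = insert (-1) (insert 1 S)"
  have Z: "finite Z" "card Z = Suc N" "Z \<subseteq> {-1..1}"
    using S assms by (force simp: Z_def card_insert_if)+
  have "pderiv (legendre N) \<noteq> 0"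
    using assms by (simp add: pderiv_eq_0_iff degree_legendre)
  then have \<omega>: "\<omega> \<noteq> 0" "degree \<omega> = Suc N"
    using assms unfolding \<omega>_def by (simp_all add: degree_mult_eq degree_pderiv degree_legendre del: mult_pCons_left)
  have roots: "Z \<subseteq> {x. poly \<omega> x = 0}"
    using S(4) by (auto simp: Z_def \<omega>_def)
  have "card {x. poly \<omega> x = 0} \<le> card Z"
    using card_poly_roots_bound[OF \<omega>(1)] \<omega>(2) Z(2) by simp
  then have Z_eq: "{x. poly \<omega> x = 0} = Z"
    using card_seteq[OF poly_roots_finite[OF \<omega>(1)] roots] by simp
  have "poly \<omega> x = (1 - x\<^sup>2) * poly (pderiv (legendre N)) x" for x
    by (simp add: \<omega>_def power2_eq_square algebra_simps)
  then have nodes: "ref_lgl_nodes N = sorted_list_of_set Z"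
    by (simp add: ref_lgl_nodes_def flip: Z_eq)
  let ?x = "ref_lgl_nodes N"
  show len: "length ?x = Suc N" using Z by (simp add: nodes)
  have set: "set ?x = Z" using Z by (simp add: nodes)
  have strict: "?x ! i < ?x ! j" if "i < j" "j \<le> N" for i j
    using that len strict_sorted_list_of_set[of Z] by (simp add: nodes sorted_wrt_iff_nth_less)
  have range: "?x ! i \<in> Z" if "i \<le> N" for i
    using that len set nth_mem[of i ?x] by simp
  have ex: "\<exists>i\<le>N. ?x ! i = z" if "z \<in> Z" for z
    using that set len by (metis in_set_conv_nth less_Suc_eq_le)
  show first: "?x ! 0 = -1"
  proof -
    obtain i where "i \<le> N" "?x ! i = -1" using ex[of "-1"] by (auto simp: Z_def)
    moreover have "?x ! 0 \<ge> -1" using range[of 0] Z(3) by auto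
    ultimately show ?thesis using strict[of 0 i] by (cases "i = 0") auto
  qed
  show last: "?x ! N = 1"
  proof -
    obtain i where "i \<le> N" "?x ! i = 1" using ex[of 1] by (auto simp: Z_def)
    moreover have "?x ! N \<le> 1" using range[of N] Z(3) by auto
    ultimately show ?thesis using strict[of i N] by (cases "i = N") auto
  qed
  let ?\<pi> = "\<Prod>m\<le>N. [:- (?x ! m), 1:]"
  have "Polynomial.smult (lead_coeff \<omega>) ?\<pi> = \<omega>"
  \<comment> \<open>Agreement at \<open>N + 1\<close> points alone would not identify polynomials of
    degree \<open>N + 1\<close>; the equal leading coefficients close the gap.\<close>
  proof (rule poly_eqI_degree_lead_coeff[where A = Z and n = "Suc N"])
    have deg: "degree ?\<pi> = Suc N" by (subst degree_prod_sum_eq) auto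
    moreover have "lead_coeff ?\<pi> = 1" by (simp add: lead_coeff_prod)
    ultimately show "poly.coeff (Polynomial.smult (lead_coeff \<omega>) ?\<pi>) (Suc N) = poly.coeff \<omega> (Suc N)"
      using \<omega>(2) by simp
    show "degree (Polynomial.smult (lead_coeff \<omega>) ?\<pi>) \<le> Suc N"
      using deg degree_smult_le by metis
    show "poly (Polynomial.smult (lead_coeff \<omega>) ?\<pi>) z = poly \<omega> z" if "z \<in> Z" for z
      using ex[OF that] that Z_eq by (auto simp: poly_prod)
  qed (use \<omega> Z in simp_all)
  then have \<pi>: "?\<pi> = Polynomial.smult (1 / lead_coeff \<omega>) \<omega>"
    using \<omega>(1) by (metis smult_smult nonzero_divide_eq_eq leading_coeff_0_iff smult_1_left times_divide_eq_left mult.commute)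
  show "lobatto_rule N ((!) ?x)"
  proof
    show "integral {?x ! 0..?x ! N} (poly (?\<pi> * q)) = 0" if "degree q + 2 \<le> N" for q
      using legendre_deriv_orthogonal[OF that]
      by (simp only: \<pi> first last mult_smult_left integral_poly_smult \<omega>_def)
  qed (use assms strict in auto)
qed

lemma lgl_nodes_nth:
  assumes "N \<ge> 1" "i \<le> N"
  shows "lgl_nodes N l r ! i = l + (r - l) / 2 * (ref_lgl_nodes N ! i + 1)"
  using assms ref_lgl_nodes_rule(4)[of N] by (simp add: lgl_nodes_def)

lemma lgl_nodes_ends:
  assumes "N \<ge> 1"
  shows "lgl_nodes N l r ! 0 = l" "lgl_nodes N l r ! N = r"
  using assms ref_lgl_nodes_rule(2,3)[of N] by (simp_all add: lgl_nodes_nth field_simps)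

text \<open>Under the affine map each factor of the node polynomial becomes
  \<open>(r - l) / 2\<close> times the reference factor, and composition preserves the degree of the
  test polynomial.\<close>

lemma lgl_nodes_rule:
  assumes "N \<ge> 1" "l < r"
  shows "lobatto_rule N ((!) (lgl_nodes N l r))"
proof
  interpret ref: lobatto_rule N "(!) (ref_lgl_nodes N)"
    by (rule ref_lgl_nodes_rule(1)[OF assms(1)])
  let ?x = "lgl_nodes N l r" and ?y = "ref_lgl_nodes N" and ?h = "(r - l) / 2"
  let ?\<phi> = "[:l + ?h, ?h:]"
  show "?x ! i < ?x ! j" if "i < j" "j \<le> N" for i j
    using that assms ref.nodes_strict_mono[OF that] by (simp add: lgl_nodes_nth)
  show "integral {?x ! 0..?x ! N} (poly ((\<Prod>m\<le>N. [:- (?x ! m), 1:]) * q)) = 0"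
    if "degree q + 2 \<le> N" for q
  proof -
    have "(\<Prod>m\<le>N. [:- (?x ! m), 1:]) \<circ>\<^sub>p ?\<phi> = (\<Prod>m\<le>N. Polynomial.smult ?h [:- (?y ! m), 1:])"
      unfolding pcompose_prod
      by (intro prod.cong) (auto simp: pcompose_pCons lgl_nodes_nth[OF assms(1)] algebra_simps
          add_divide_distrib diff_divide_distrib)
    also have "\<dots> = Polynomial.smult (?h ^ Suc N) (\<Prod>m\<le>N. [:- (?y ! m), 1:])"
      by (simp only: prod_smult prod_constant card_atMost)
    finally have comp: "((\<Prod>m\<le>N. [:- (?x ! m), 1:]) * q) \<circ>\<^sub>p ?\<phi>
        = Polynomial.smult (?h ^ Suc N) ((\<Prod>m\<le>N. [:- (?y ! m), 1:]) * (q \<circ>\<^sub>p ?\<phi>))"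
      by (simp only: pcompose_mult mult_smult_left)
    have "integral {l..r} (poly ((\<Prod>m\<le>N. [:- (?x ! m), 1:]) * q)) =
        ?h * integral {-1..1} (poly (((\<Prod>m\<le>N. [:- (?x ! m), 1:]) * q) \<circ>\<^sub>p ?\<phi>))"
      using assms(2) by (intro integral_poly_affine) simp
    also have "\<dots> = ?h * (?h ^ Suc N *
        integral {-1..1} (poly ((\<Prod>m\<le>N. [:- (?y ! m), 1:]) * (q \<circ>\<^sub>p ?\<phi>))))"
      by (simp only: comp integral_poly_smult)
    also have "\<dots> = 0"
    proof -
      have "degree (q \<circ>\<^sub>p ?\<phi>) + 2 \<le> N"
        using that assms(2) by (simp add: degree_pcompose)
      from ref.node_poly_orthogonal[OF this] show ?thesis
        using ref_lgl_nodes_rule(2,3)[OF assms(1)] by simp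
    qed
    finally show ?thesis
      using lgl_nodes_ends[OF assms(1)] by simp
  qed
qed (rule assms)

lemma lgl_rule_eqs:
  assumes "N \<ge> 1" "l < r"
  shows "lobatto_rule.basis N ((!) (lgl_nodes N l r)) = lagrange_basis N l r"
    "lobatto_rule.weight N ((!) (lgl_nodes N l r)) = lgl_weight N l r"
proof -
  interpret lobatto_rule N "(!) (lgl_nodes N l r)"
    by (rule lgl_nodes_rule[OF assms])
  show "basis = lagrange_basis N l r"
    by (simp add: fun_eq_iff basis_def lagrange_basis_def Let_def)
  then show "weight = lgl_weight N l r"
    by (simp add: fun_eq_iff weight_def lgl_weight_def lgl_nodes_ends[OF assms(1)])
qed

lemma lgl_weight_pos:
  assumes "N \<ge> 1" "l < r" "i \<le> N"
  shows "lgl_weight N l r i > 0"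
  using lobatto_rule.weight_pos[OF lgl_nodes_rule[OF assms(1,2)] assms(3)]
  by (simp add: lgl_rule_eqs[OF assms(1,2)])

lemma lgl_summation_by_parts:
  assumes "N \<ge> 1" "l < r"
  shows "(\<Sum>i<Suc N. lgl_weight N l r i * (f i * (\<Sum>j<Suc N. lgl_diff_mat N l r $$ (i, j) * g j)))
    + (\<Sum>i<Suc N. lgl_weight N l r i * ((\<Sum>j<Suc N. lgl_diff_mat N l r $$ (i, j) * f j) * g i))
    = f N * g N - f 0 * g 0"
proof -
  interpret lobatto_rule N "(!) (lgl_nodes N l r)"
    by (rule lgl_nodes_rule[OF assms])
  have "diff h i = (\<Sum>j<Suc N. lgl_diff_mat N l r $$ (i, j) * h j)" if "i < Suc N" for h i
    using that by (auto simp: diff_def lgl_diff_mat_def lgl_rule_eqs[OF assms] lessThan_Suc_atMost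
        intro!: sum.cong)
  then show ?thesis
    using summation_by_parts[of f g] by (simp add: lgl_rule_eqs[OF assms] flip: lessThan_Suc_atMost)
qed

section \<open>Kronecker products\<close>

text \<open>This is the index splitting behind all Kronecker products below: the quotient
  \<open>i\<close> is the slow index (time), the remainder \<open>j\<close> the fast one
  (space).\<close>

lemma sum_less_mult:
  fixes f :: "nat \<Rightarrow> 'a :: comm_monoid_add"
  shows "(\<Sum>i<m * n. f i) = (\<Sum>i<m. \<Sum>j<n. f (i * n + j))"
proof -
  have "(\<Sum>j<n. f (i * n + j)) = sum f {i * n..<i * n + n}" for i
    using sum.shift_bounds_nat_ivl[of f 0 "i * n" n] by (simp add: atLeast0LessThan add.commute)
  then show ?thesis by (simp add: sum.nat_group)
qed

lemma mult_add_less_mult: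
  fixes i j m n :: nat
  assumes "i < m" "j < n"
  shows "i * n + j < m * n"
proof -
  have "i * n + j < Suc i * n" using assms(2) by simp
  also have "\<dots> \<le> m * n" using assms(1) by (intro mult_le_mono1) simp
  finally show ?thesis .
qed

lemma kron_carrier:
  assumes "A \<in> carrier_mat r1 c1" "B \<in> carrier_mat r2 c2"
  shows "A \<otimes>\<^sub>K B \<in> carrier_mat (r1 * r2) (c1 * c2)"
  using assms by (auto simp: kron_def)

lemma kron_mult_vec_nth:
  assumes A: "A \<in> carrier_mat r1 c1" and B: "B \<in> carrier_mat r2 c2"
    and v: "v \<in> carrier_vec (c1 * c2)" and i: "i < r1" and j: "j < r2"
  shows "((A \<otimes>\<^sub>K B) *\<^sub>v v) $ (i * r2 + j)
    = (\<Sum>k<c1. \<Sum>l<c2. A $$ (i, k) * B $$ (j, l) * v $ (k * c2 + l))"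
proof -
  have bound: "i * r2 + j < r1 * r2" by (rule mult_add_less_mult[OF i j])
  have "((A \<otimes>\<^sub>K B) *\<^sub>v v) $ (i * r2 + j) = (\<Sum>k<c1 * c2. (A \<otimes>\<^sub>K B) $$ (i * r2 + j, k) * v $ k)"
    using kron_carrier[OF A B] v bound
    by (simp add: scalar_prod_def row_def atLeast0LessThan)
  also have "\<dots> = (\<Sum>k<c1. \<Sum>l<c2. A $$ (i, k) * B $$ (j, l) * v $ (k * c2 + l))"
    unfolding sum_less_mult
    using A B bound j by (intro sum.cong refl) (auto simp: kron_def mult_add_less_mult)
  finally show ?thesis .
qed

lemma one_mat_kron_mult_vec_nth:
  assumes B: "B \<in> carrier_mat r2 c2"
    and v: "v \<in> carrier_vec (n * c2)" and i: "i < n" and j: "j < r2"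
  shows "((1\<^sub>m n \<otimes>\<^sub>K B) *\<^sub>v v) $ (i * r2 + j) = (\<Sum>l<c2. B $$ (j, l) * v $ (i * c2 + l))"
proof -
  have "((1\<^sub>m n \<otimes>\<^sub>K B) *\<^sub>v v) $ (i * r2 + j)
      = (\<Sum>k<n. if k = i then \<Sum>l<c2. B $$ (j, l) * v $ (i * c2 + l) else 0)"
    unfolding kron_mult_vec_nth[OF one_carrier_mat B v i j]
    using i by (intro sum.cong) auto
  then show ?thesis using i by simp
qed

lemma kron_one_mat_mult_vec_nth:
  assumes A: "A \<in> carrier_mat r1 c1"
    and v: "v \<in> carrier_vec (c1 * n)" and i: "i < r1" and j: "j < n"
  shows "((A \<otimes>\<^sub>K 1\<^sub>m n) *\<^sub>v v) $ (i * n + j) = (\<Sum>k<c1. A $$ (i, k) * v $ (k * n + j))"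
  unfolding kron_mult_vec_nth[OF A one_carrier_mat v i j]
proof (intro sum.cong refl)
  fix k
  have "(\<Sum>l<n. A $$ (i, k) * 1\<^sub>m n $$ (j, l) * v $ (k * n + l))
      = (\<Sum>l<n. if l = j then A $$ (i, k) * v $ (k * n + j) else 0)"
    using j by (intro sum.cong) auto
  then show "(\<Sum>l<n. A $$ (i, k) * 1\<^sub>m n $$ (j, l) * v $ (k * n + l)) = A $$ (i, k) * v $ (k * n + j)"
    using j by simp
qed

lemma row_mat_carrier: "v \<in> carrier_vec n \<Longrightarrow> row_mat v \<in> carrier_mat 1 n"
  by (auto simp: row_mat_def)

lemma row_mat_unit_vec_nth:
  assumes "l < n" "e < n"
  shows "row_mat (unit_vec n e) $$ (0, l) = (if l = e then 1 else 0)"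
  using assms by (simp add: row_mat_def mat_of_rows_def unit_vec_def)

lemma kron_mat_diag:
  "mat_diag m f \<otimes>\<^sub>K mat_diag n g = mat_diag (m * n) (\<lambda>i. f (i div n) * g (i mod n))"
proof (rule eq_matI)
  fix i j assume *: "i < dim_row (mat_diag (m * n) (\<lambda>i. f (i div n) * g (i mod n)))"
    "j < dim_col (mat_diag (m * n) (\<lambda>i. f (i div n) * g (i mod n)))"
  then have "i div n < m" "j div n < m" "i mod n < n" "j mod n < n" "i < m * n" "j < m * n"
    by (auto simp: mat_diag_def less_mult_imp_div_less intro!: mod_less_divisor gr_zeroI)
  moreover have "i div n = j div n \<and> i mod n = j mod n \<longleftrightarrow> i = j"
    by (metis div_mult_mod_eq)
  ultimately show "(mat_diag m f \<otimes>\<^sub>K mat_diag n g) $$ (i, j)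
      = mat_diag (m * n) (\<lambda>i. f (i div n) * g (i mod n)) $$ (i, j)"
    by (auto simp: kron_def mat_diag_def)
qed (auto simp: kron_def mat_diag_def)

section \<open>Diagonal inner products\<close>

text \<open>The bilinear form of a diagonal matrix, kept as a sum over nodes so that estimates can
  be proved node by node instead of by matrix algebra.\<close>

definition wip :: "nat \<Rightarrow> (nat \<Rightarrow> real) \<Rightarrow> real Matrix.vec \<Rightarrow> real Matrix.vec \<Rightarrow> real" where
  "wip n w y z = (\<Sum>i<n. w i * (y $ i * z $ i))"

lemma scalar_prod_mat_diag:
  assumes "z \<in> carrier_vec n"
  shows "y \<bullet> (mat_diag n w *\<^sub>v z) = wip n w y z"
proof -
  have "(mat_diag n w *\<^sub>v z) $ i = w i * z $ i" if "i < n" for i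
  proof -
    have "(mat_diag n w *\<^sub>v z) $ i = (\<Sum>j<n. (if i = j then w j else 0) * z $ j)"
      using that assms by (simp add: mat_diag_def scalar_prod_def row_def atLeast0LessThan)
    also have "\<dots> = (\<Sum>j<n. if j = i then w i * z $ i else 0)"
      by (intro sum.cong) auto
    finally show ?thesis using that by simp
  qed
  moreover have "dim_vec (mat_diag n w *\<^sub>v z) = n" by (simp add: mat_diag_def)
  ultimately show ?thesis
    unfolding scalar_prod_def wip_def by (auto simp: atLeast0LessThan intro!: sum.cong)
qed

lemma wip_commute: "wip n w y z = wip n w z y"
  by (simp add: wip_def mult.commute)

lemma wip_diff_right:
  assumes "z2 \<in> carrier_vec n"
  shows "wip n w y (z1 - z2) = wip n w y z1 - wip n w y z2"
  unfolding wip_def sum_subtractf[symmetric]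
  using assms by (intro sum.cong) (auto simp: algebra_simps)

lemma wip_add_right:
  assumes "z2 \<in> carrier_vec n"
  shows "wip n w y (z1 + z2) = wip n w y z1 + wip n w y z2"
  unfolding wip_def sum.distrib[symmetric]
  using assms by (intro sum.cong) (auto simp: algebra_simps)

lemma wip_smult_right:
  assumes "z \<in> carrier_vec n"
  shows "wip n w y (c \<cdot>\<^sub>v z) = c * wip n w y z"
  unfolding wip_def sum_distrib_left
  using assms by (intro sum.cong) auto

lemma wip_uminus_right:
  assumes "z \<in> carrier_vec n"
  shows "wip n w y (- z) = - wip n w y z"
  unfolding wip_def sum_negf[symmetric]
  using assms by (intro sum.cong) auto

lemma wip_zero_right: "wip n w y (0\<^sub>v n) = 0"
  unfolding wip_def by (intro sum.neutral) auto

lemma wip_smult_left: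
  assumes "y \<in> carrier_vec r"
  shows "wip r w (a \<cdot>\<^sub>v y) z = a * wip r w y z"
  using wip_smult_right[OF assms, of w z a] by (simp add: wip_commute[of r w z])

lemmas wip_right_simps = wip_diff_right wip_add_right wip_smult_right wip_uminus_right wip_zero_right

lemma wip_nonneg:
  assumes "\<And>i. i < n \<Longrightarrow> w i \<ge> 0"
  shows "wip n w y y \<ge> 0"
  unfolding wip_def using assms by (intro sum_nonneg) auto

lemma wip_unit_vec: "e < n \<Longrightarrow> wip n w (unit_vec n e) (unit_vec n e) = w e"
  by (simp add: wip_def unit_vec_def sum.delta if_distrib[of "\<lambda>x. x * _"] if_distrib[of "\<lambda>x. _ * x"]
      cong: if_cong)

lemma smult_mat_mult_vec:
  fixes A :: "real Matrix.mat"
  assumes "A \<in> carrier_mat r d" "x \<in> carrier_vec d"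
  shows "(a \<cdot>\<^sub>m A) *\<^sub>v x = a \<cdot>\<^sub>v (A *\<^sub>v x)"
  using assms by (intro eq_vecI) auto

text \<open>\<open>inv_mat\<close> unwraps an option, so it must first be known that
  \<open>mat_inverse\<close> succeeds. The diagonal matrix of reciprocals exhibits a unit, which
  rules out \<open>None\<close>.\<close>

lemma mat_diag_mult_inv_mat:
  assumes "\<And>i. i < n \<Longrightarrow> f i \<noteq> 0"
  shows "mat_diag n f * inv_mat (mat_diag n f) = 1\<^sub>m n"
    "inv_mat (mat_diag n f) \<in> carrier_mat n n"
proof -
  let ?A = "mat_diag n f" and ?B = "mat_diag n (\<lambda>i. 1 / f i)"
  have "mat_diag n (\<lambda>i. f i * (1 / f i)) = (1\<^sub>m n :: real Matrix.mat)"
    using assms by (intro eq_matI) (auto simp: mat_diag_def)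
  then have "?A * ?B = 1\<^sub>m n" "?B * ?A = 1\<^sub>m n"
    by (simp_all only: mat_diag_diag mult.commute)
  then have "?A \<in> Units (ring_mat TYPE(real) n ())"
    by (auto simp: Units_def ring_mat_simps intro!: bexI[of _ ?B])
  then obtain C where "mat_inverse ?A = Some C"
    using mat_inverse(1)[of ?A n "()"] by (cases "mat_inverse ?A") auto
  with mat_inverse(2)[of ?A n C] show "?A * inv_mat ?A = 1\<^sub>m n" "inv_mat ?A \<in> carrier_mat n n"
    by (auto simp: inv_mat_def)
qed

section \<open>Scalar penalty inequalities and their weighted sums\<close>

text \<open>The constant is sharp: as a concave quadratic in \<open>u\<close>, the left side is
  largest at \<open>u = \<sigma> * q / (2 * \<sigma> - 1)\<close>, where equality holds.\<close>

lemma initial_penalty_bound: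
  fixes \<sigma> u q :: real
  assumes "\<sigma> > 1 / 2"
  shows "u\<^sup>2 - 2 * \<sigma> * (u * (u - q)) \<le> \<sigma>\<^sup>2 / (2 * \<sigma> - 1) * q\<^sup>2"
proof -
  have "0 \<le> ((2 * \<sigma> - 1) * u - \<sigma> * q)\<^sup>2 / (2 * \<sigma> - 1)"
    using assms by simp
  also have "\<dots> = (2 * \<sigma> - 1) * u\<^sup>2 - 2 * \<sigma> * u * q + \<sigma>\<^sup>2 / (2 * \<sigma> - 1) * q\<^sup>2"
    using assms by (simp add: power2_eq_square field_simps)
  finally show ?thesis by (simp add: algebra_simps power2_eq_square)
qed

text \<open>Half of the penalty's \<open>u^2\<close> pays for the flux. Splitting
  \<open>2 * \<sigma> * u * (u - h)\<close> into \<open>\<sigma> * (u^2 + (u - h)^2 - h^2)\<close>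
  frees \<open>\<sigma> * u^2\<close>, and \<open>\<kappa> / (2 * p) * u^2\<close> is exactly what
  completes the flux and dissipation terms to a square.\<close>

lemma boundary_penalty_bound:
  fixes \<kappa> p \<sigma> u d h :: real
  assumes "\<kappa> > 0" "p > 0" "\<sigma> \<ge> \<kappa> / (2 * p)"
  shows "- (2 * (\<kappa> * (u * d)) + 2 * (\<kappa> * p * d\<^sup>2) + 2 * \<sigma> * (u * (u - h))) \<le> \<sigma> * h\<^sup>2"
proof -
  have "0 \<le> 2 * \<kappa> * p * (d + u / (2 * p))\<^sup>2 + (\<sigma> - \<kappa> / (2 * p)) * u\<^sup>2 + \<sigma> * (u - h)\<^sup>2"
    using assms order_trans[of 0 "\<kappa> / (2 * p)" \<sigma>] by (intro add_nonneg_nonneg) auto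
  also have "\<dots> = 2 * \<kappa> * (u * d) + 2 * (\<kappa> * p * d\<^sup>2) + 2 * \<sigma> * (u * (u - h)) + \<sigma> * h\<^sup>2"
    using assms by (simp add: power2_eq_square field_simps)
  finally show ?thesis by simp
qed

lemma wip_initial_penalty_bound:
  assumes "\<sigma> > 1 / 2" and w: "\<And>i. i < n \<Longrightarrow> w i \<ge> 0" and q: "q \<in> carrier_vec n"
  shows "wip n w y y - 2 * \<sigma> * wip n w y (y - q) \<le> \<sigma>\<^sup>2 / (2 * \<sigma> - 1) * wip n w q q"
proof -
  have "wip n w y y - 2 * \<sigma> * wip n w y (y - q)
      = (\<Sum>i<n. w i * ((y $ i)\<^sup>2 - 2 * \<sigma> * (y $ i * (y $ i - q $ i))))"
    unfolding wip_def sum_distrib_left sum_subtractf[symmetric]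
    using q by (intro sum.cong) (auto simp: algebra_simps power2_eq_square)
  also have "\<dots> \<le> (\<Sum>i<n. w i * (\<sigma>\<^sup>2 / (2 * \<sigma> - 1) * (q $ i)\<^sup>2))"
    using w by (intro sum_mono mult_left_mono initial_penalty_bound assms(1)) auto
  also have "\<dots> = \<sigma>\<^sup>2 / (2 * \<sigma> - 1) * wip n w q q"
    unfolding wip_def sum_distrib_left by (intro sum.cong) (simp_all add: power2_eq_square)
  finally show ?thesis .
qed

text \<open>The sign \<open>e\<close> treats both ends at once: it is 1 at the west face and -1 at
  the east face, where the flux enters the energy balance with the opposite sign. Replacing
  \<open>d\<close> by \<open>e * d\<close> leaves the dissipation unchanged.\<close>

lemma wip_boundary_penalty_bound:
  assumes "\<kappa> > 0" "p > 0" "\<sigma> \<ge> \<kappa> / (2 * p)" and w: "\<And>i. i < n \<Longrightarrow> w i \<ge> 0"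
    and h: "h \<in> carrier_vec n" and e: "e\<^sup>2 = 1"
  shows "- (2 * (e * (\<kappa> * wip n w y d)) + 2 * (\<kappa> * (p * wip n w d d)) + 2 * (\<sigma> * wip n w y (y - h)))
    \<le> \<sigma> * wip n w h h"
proof -
  have "- (2 * (e * (\<kappa> * wip n w y d)) + 2 * (\<kappa> * (p * wip n w d d)) + 2 * (\<sigma> * wip n w y (y - h)))
      = (\<Sum>i<n. w i * - (2 * (\<kappa> * (y $ i * (e * d $ i))) + 2 * (\<kappa> * p * (e * d $ i)\<^sup>2)
          + 2 * \<sigma> * (y $ i * (y $ i - h $ i))))"
    unfolding wip_def sum_distrib_left sum.distrib[symmetric] sum_negf[symmetric]
    using h e by (intro sum.cong) (auto simp: algebra_simps power2_eq_square)
  also have "\<dots> \<le> (\<Sum>i<n. w i * (\<sigma> * (h $ i)\<^sup>2))"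
    using w by (intro sum_mono mult_left_mono boundary_penalty_bound assms(1-3)) auto
  also have "\<dots> = \<sigma> * wip n w h h"
    unfolding wip_def sum_distrib_left by (intro sum.cong) (simp_all add: power2_eq_square)
  finally show ?thesis .
qed

text \<open>Regroups contributions by interface: the one between elements \<open>k\<close> and
  \<open>k + 1\<close> receives \<open>B k\<close> from its left and \<open>A (Suc k)\<close> from
  its right neighbour.\<close>

lemma interface_sum:
  fixes A B :: "nat \<Rightarrow> real"
  assumes "K \<ge> 1"
  shows "(\<Sum>k = 1..K. (if 2 \<le> k then A k else 0) + (if k < K then B k else 0))
    = (\<Sum>k = 1..<K. A (Suc k) + B k)"
proof -
  have "(\<Sum>k = 1..K. if 2 \<le> k then A k else 0) = (\<Sum>k = 1..<K. A (Suc k))"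
    using assms by (induction K rule: dec_induct) auto
  moreover have "(\<Sum>k = 1..K. if k < K then B k else 0) = (\<Sum>k = 1..<K. B k)"
    using assms by (intro sum.mono_neutral_cong_right) auto
  ultimately show ?thesis by (simp add: sum.distrib)
qed

section \<open>Space--time operators and the energy estimate\<close>

locale sbp_mesh =
  fixes M :: mesh
  assumes final_time_pos: "final_time M > 0"
    and x_degree_pos: "x_degree M \<ge> 1" and t_degree_pos: "t_degree M \<ge> 1"
    and elem_less: "\<And>k. k \<in> {1..num_elems M} \<Longrightarrow> left_end M k < right_end M k"
begin

text \<open>The sizes \<open>n\<close> and \<open>m\<close> are successors; products with them must
  stay folded to preserve the index form \<open>\<tau> * n + \<xi>\<close>.\<close>

declare mult_Suc [simp del] mult_Suc_right [simp del]

abbreviation n where "n \<equiv> Suc (x_degree M)"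
abbreviation m where "m \<equiv> Suc (t_degree M)"

abbreviation wx :: "nat \<Rightarrow> nat \<Rightarrow> real" where
  "wx k \<equiv> lgl_weight (x_degree M) (left_end M k) (right_end M k)"

abbreviation wt :: "nat \<Rightarrow> real" where
  "wt \<equiv> lgl_weight (t_degree M) 0 (final_time M)"

abbreviation ipx :: "nat \<Rightarrow> real Matrix.vec \<Rightarrow> real Matrix.vec \<Rightarrow> real" where
  "ipx k \<equiv> wip n (wx k)"

abbreviation ipt :: "real Matrix.vec \<Rightarrow> real Matrix.vec \<Rightarrow> real" where
  "ipt \<equiv> wip m wt"

abbreviation ip :: "nat \<Rightarrow> real Matrix.vec \<Rightarrow> real Matrix.vec \<Rightarrow> real" where
  "ip k \<equiv> wip (num_dofs M) (\<lambda>i. wt (i div n) * wx k (i mod n))"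

lemma I_eq: "I_x M = 1\<^sub>m n" "I_t M = 1\<^sub>m m"
  by (simp_all add: I_x_def I_t_def)

lemma num_dofs_eq: "num_dofs M = m * n"
  by (simp add: num_dofs_def)

lemma wt_pos: "\<tau> < m \<Longrightarrow> wt \<tau> > 0"
  using lgl_weight_pos[OF t_degree_pos final_time_pos] by simp

lemma wx_pos: "k \<in> {1..num_elems M} \<Longrightarrow> \<xi> < n \<Longrightarrow> wx k \<xi> > 0"
  using lgl_weight_pos[OF x_degree_pos elem_less] by simp

lemma Px_bar_eq: "Px_bar M k = mat_diag n (wx k)"
  by (simp add: Px_bar_def lgl_weight_mat_def)

lemma Pt_bar_eq: "Pt_bar M = mat_diag m wt"
  by (simp add: Pt_bar_def lgl_weight_mat_def)

lemma P_st_eq: "P_st M k = mat_diag (num_dofs M) (\<lambda>i. wt (i div n) * wx k (i mod n))"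
  unfolding P_st_def Px_bar_eq Pt_bar_eq kron_mat_diag num_dofs_eq ..

lemma Dx_bar_carrier: "Dx_bar M k \<in> carrier_mat n n"
  by (simp add: Dx_bar_def lgl_diff_mat_def)

lemma Dt_bar_carrier: "Dt_bar M \<in> carrier_mat m m"
  by (simp add: Dt_bar_def lgl_diff_mat_def)

lemma e_carriers: "e_w M \<in> carrier_vec n" "e_e M \<in> carrier_vec n"
    "e_s M \<in> carrier_vec m" "e_n M \<in> carrier_vec m"
  by (simp_all add: e_w_def e_e_def e_s_def e_n_def)

lemma operator_carriers [simp]:
  "D_x M k \<in> carrier_mat (num_dofs M) (num_dofs M)"
  "D_t M \<in> carrier_mat (num_dofs M) (num_dofs M)"
  "R_w M \<in> carrier_mat m (num_dofs M)" "R_e M \<in> carrier_mat m (num_dofs M)"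
  "R_s M \<in> carrier_mat n (num_dofs M)" "R_n M \<in> carrier_mat n (num_dofs M)"
  "Px_bar M k \<in> carrier_mat n n" "Pt_bar M \<in> carrier_mat m m"
  "P_st M k \<in> carrier_mat (num_dofs M) (num_dofs M)"
  using kron_carrier[OF one_carrier_mat[of m] Dx_bar_carrier]
    kron_carrier[OF Dt_bar_carrier one_carrier_mat[of n]]
    kron_carrier[OF one_carrier_mat[of m] row_mat_carrier[OF e_carriers(1)]]
    kron_carrier[OF one_carrier_mat[of m] row_mat_carrier[OF e_carriers(2)]]
    kron_carrier[OF row_mat_carrier[OF e_carriers(3)] one_carrier_mat[of n]]
    kron_carrier[OF row_mat_carrier[OF e_carriers(4)] one_carrier_mat[of n]]
  by (simp_all add: D_x_def D_t_def R_w_def R_e_def R_s_def R_n_def I_eq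
      num_dofs_eq Px_bar_eq Pt_bar_eq P_st_eq del: One_nat_def)

lemma ip_scalar_prod:
  assumes "z \<in> carrier_vec (num_dofs M)"
  shows "ip k y z = y \<bullet> (P_st M k *\<^sub>v z)"
  using scalar_prod_mat_diag[OF assms] by (simp add: P_st_eq)

lemma ip_eq: "ip k y z = (\<Sum>\<tau><m. \<Sum>\<xi><n. wt \<tau> * wx k \<xi> * (y $ (\<tau> * n + \<xi>) * z $ (\<tau> * n + \<xi>)))"
  unfolding wip_def num_dofs_eq sum_less_mult
  by (intro sum.cong refl) simp

context
  fixes v :: "real Matrix.vec"
  assumes v: "v \<in> carrier_vec (num_dofs M)"
begin

lemma v_mn: "v \<in> carrier_vec (m * n)"
  using v by (simp only: num_dofs_eq)

lemma D_x_nth: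
  assumes "\<tau> < m" "\<xi> < n"
  shows "(D_x M k *\<^sub>v v) $ (\<tau> * n + \<xi>) = (\<Sum>l<n. Dx_bar M k $$ (\<xi>, l) * v $ (\<tau> * n + l))"
  using one_mat_kron_mult_vec_nth[OF Dx_bar_carrier v_mn assms]
  by (simp add: D_x_def I_eq)

lemma D_t_nth:
  assumes "\<tau> < m" "\<xi> < n"
  shows "(D_t M *\<^sub>v v) $ (\<tau> * n + \<xi>) = (\<Sum>l<m. Dt_bar M $$ (\<tau>, l) * v $ (l * n + \<xi>))"
  using kron_one_mat_mult_vec_nth[OF Dt_bar_carrier v_mn assms]
  by (simp add: D_t_def I_eq)

lemma R_x_nth:
  assumes "\<tau> < m" "e < n"
  shows "((1\<^sub>m m \<otimes>\<^sub>K row_mat (unit_vec n e)) *\<^sub>v v) $ \<tau> = v $ (\<tau> * n + e)"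
proof -
  have "((1\<^sub>m m \<otimes>\<^sub>K row_mat (unit_vec n e)) *\<^sub>v v) $ \<tau>
      = (\<Sum>l<n. row_mat (unit_vec n e) $$ (0, l) * v $ (\<tau> * n + l))"
    using one_mat_kron_mult_vec_nth[OF row_mat_carrier[OF unit_vec_carrier] v_mn assms(1), of 0]
    by (simp del: One_nat_def sum.lessThan_Suc)
  also have "\<dots> = (\<Sum>l<n. if l = e then v $ (\<tau> * n + e) else 0)"
    using assms(2) by (intro sum.cong) (auto simp: row_mat_unit_vec_nth)
  finally show ?thesis using assms(2) by simp
qed

lemma R_t_nth:
  assumes "\<xi> < n" "e < m"
  shows "((row_mat (unit_vec m e) \<otimes>\<^sub>K 1\<^sub>m n) *\<^sub>v v) $ \<xi> = v $ (e * n + \<xi>)"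
proof -
  have "((row_mat (unit_vec m e) \<otimes>\<^sub>K 1\<^sub>m n) *\<^sub>v v) $ \<xi>
      = (\<Sum>l<m. row_mat (unit_vec m e) $$ (0, l) * v $ (l * n + \<xi>))"
    using kron_one_mat_mult_vec_nth[OF row_mat_carrier[OF unit_vec_carrier] v_mn _ assms(1), of 0]
    by (simp del: One_nat_def sum.lessThan_Suc)
  also have "\<dots> = (\<Sum>l<m. if l = e then v $ (e * n + \<xi>) else 0)"
    using assms(2) by (intro sum.cong) (auto simp: row_mat_unit_vec_nth)
  finally show ?thesis using assms(2) by simp
qed

text \<open>The \<open>+ 0\<close> here and the \<open>0 * n\<close> in \<open>R_s_nth\<close> are
  kept so that the boundary values have the same index shape as the instances of
  \<open>lgl_summation_by_parts\<close>.\<close>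

lemma R_w_nth: "\<tau> < m \<Longrightarrow> (R_w M *\<^sub>v v) $ \<tau> = v $ (\<tau> * n + 0)"
  using R_x_nth[of \<tau> 0] by (simp add: R_w_def I_eq e_w_def)

lemma R_e_nth: "\<tau> < m \<Longrightarrow> (R_e M *\<^sub>v v) $ \<tau> = v $ (\<tau> * n + x_degree M)"
  using R_x_nth[of \<tau> "x_degree M"] by (simp add: R_e_def I_eq e_e_def)

lemma R_s_nth: "\<xi> < n \<Longrightarrow> (R_s M *\<^sub>v v) $ \<xi> = v $ (0 * n + \<xi>)"
  using R_t_nth[of \<xi> 0] by (simp add: R_s_def I_eq e_s_def)

lemma R_n_nth: "\<xi> < n \<Longrightarrow> (R_n M *\<^sub>v v) $ \<xi> = v $ (t_degree M * n + \<xi>)"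
  using R_t_nth[of \<xi> "t_degree M"] by (simp add: R_n_def I_eq e_n_def)

lemma restrictions_carrier [simp]:
  "R_w M *\<^sub>v v \<in> carrier_vec m" "R_e M *\<^sub>v v \<in> carrier_vec m"
  "R_s M *\<^sub>v v \<in> carrier_vec n" "R_n M *\<^sub>v v \<in> carrier_vec n"
  "D_x M k *\<^sub>v v \<in> carrier_vec (num_dofs M)" "D_t M *\<^sub>v v \<in> carrier_vec (num_dofs M)"
  using v by (simp_all add: mult_mat_vec_carrier[OF operator_carriers(1)]
    mult_mat_vec_carrier[OF operator_carriers(2)] mult_mat_vec_carrier[OF operator_carriers(3)]
    mult_mat_vec_carrier[OF operator_carriers(4)] mult_mat_vec_carrier[OF operator_carriers(5)]
    mult_mat_vec_carrier[OF operator_carriers(6)])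

end

text \<open>At each time level this is the one-dimensional identity; summing with the time weights
  gives the face products.\<close>

lemma space_summation_by_parts:
  assumes k: "k \<in> {1..num_elems M}"
    and v: "v \<in> carrier_vec (num_dofs M)" and z: "z \<in> carrier_vec (num_dofs M)"
  shows "ip k v (D_x M k *\<^sub>v z) + ip k (D_x M k *\<^sub>v v) z
    = ipt (R_e M *\<^sub>v v) (R_e M *\<^sub>v z) - ipt (R_w M *\<^sub>v v) (R_w M *\<^sub>v z)"
proof -
  have "ip k v (D_x M k *\<^sub>v z) + ip k (D_x M k *\<^sub>v v) z = (\<Sum>\<tau><m. wt \<tau> *
     ((\<Sum>\<xi><n. wx k \<xi> * (v $ (\<tau> * n + \<xi>) * (\<Sum>l<n. Dx_bar M k $$ (\<xi>, l) * z $ (\<tau> * n + l)))) +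
      (\<Sum>\<xi><n. wx k \<xi> * ((\<Sum>l<n. Dx_bar M k $$ (\<xi>, l) * v $ (\<tau> * n + l)) * z $ (\<tau> * n + \<xi>)))))"
    unfolding ip_eq sum.distrib[symmetric] distrib_left sum_distrib_left[of "wt _"]
    by (intro sum.cong refl) (simp add: D_x_nth v z mult.assoc)
  also have "\<dots> = (\<Sum>\<tau><m. wt \<tau> *
     (v $ (\<tau> * n + x_degree M) * z $ (\<tau> * n + x_degree M) - v $ (\<tau> * n + 0) * z $ (\<tau> * n + 0)))"
    unfolding Dx_bar_def
    by (subst lgl_summation_by_parts[OF x_degree_pos elem_less[OF k]]) (rule refl)
  also have "\<dots> = ipt (R_e M *\<^sub>v v) (R_e M *\<^sub>v z) - ipt (R_w M *\<^sub>v v) (R_w M *\<^sub>v z)"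
    unfolding wip_def sum_subtractf[symmetric]
    by (intro sum.cong refl) (simp add: R_e_nth R_w_nth v z right_diff_distrib)
  finally show ?thesis .
qed

lemma time_summation_by_parts:
  assumes v: "v \<in> carrier_vec (num_dofs M)" and z: "z \<in> carrier_vec (num_dofs M)"
  shows "ip k v (D_t M *\<^sub>v z) + ip k (D_t M *\<^sub>v v) z
    = ipx k (R_n M *\<^sub>v v) (R_n M *\<^sub>v z) - ipx k (R_s M *\<^sub>v v) (R_s M *\<^sub>v z)"
proof -
  have "ip k v (D_t M *\<^sub>v z) + ip k (D_t M *\<^sub>v v) z = (\<Sum>\<xi><n. wx k \<xi> *
     ((\<Sum>\<tau><m. wt \<tau> * (v $ (\<tau> * n + \<xi>) * (\<Sum>l<m. Dt_bar M $$ (\<tau>, l) * z $ (l * n + \<xi>)))) +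
      (\<Sum>\<tau><m. wt \<tau> * ((\<Sum>l<m. Dt_bar M $$ (\<tau>, l) * v $ (l * n + \<xi>)) * z $ (\<tau> * n + \<xi>)))))"
    unfolding ip_eq sum.distrib[symmetric] distrib_left sum_distrib_left[of "wx _ _"]
    by (subst sum.swap, intro sum.cong refl) (simp add: D_t_nth v z mult_ac)
  also have "\<dots> = (\<Sum>\<xi><n. wx k \<xi> *
     (v $ (t_degree M * n + \<xi>) * z $ (t_degree M * n + \<xi>) - v $ (0 * n + \<xi>) * z $ (0 * n + \<xi>)))"
    unfolding Dt_bar_def
    by (subst lgl_summation_by_parts[OF t_degree_pos final_time_pos]) (rule refl)
  also have "\<dots> = ipx k (R_n M *\<^sub>v v) (R_n M *\<^sub>v z) - ipx k (R_s M *\<^sub>v v) (R_s M *\<^sub>v z)"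
    unfolding wip_def sum_subtractf[symmetric]
    by (intro sum.cong refl) (simp add: R_n_nth R_s_nth v z right_diff_distrib)
  finally show ?thesis .
qed

text \<open>All terms are nonnegative, so only the two boundary columns are kept. Being distinct
  columns, they can serve both ends of one element simultaneously. It is applied to
  \<open>D_x u\<close>.\<close>

lemma ip_ge_boundary:
  assumes k: "k \<in> {1..num_elems M}" and v: "v \<in> carrier_vec (num_dofs M)"
  shows "ip k v v \<ge> wx k 0 * ipt (R_w M *\<^sub>v v) (R_w M *\<^sub>v v)
    + wx k (x_degree M) * ipt (R_e M *\<^sub>v v) (R_e M *\<^sub>v v)"
proof -
  have "wx k 0 * ipt (R_w M *\<^sub>v v) (R_w M *\<^sub>v v)
      + wx k (x_degree M) * ipt (R_e M *\<^sub>v v) (R_e M *\<^sub>v v)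
    = (\<Sum>\<tau><m. \<Sum>\<xi>\<in>{0, x_degree M}. wt \<tau> * wx k \<xi> * (v $ (\<tau> * n + \<xi>) * v $ (\<tau> * n + \<xi>)))"
    unfolding wip_def sum_distrib_left sum.distrib[symmetric]
    using x_degree_pos by (intro sum.cong refl) (simp add: R_w_nth R_e_nth v mult_ac)
  also have "\<dots> \<le> ip k v v"
  proof -
    have "0 \<le> wt \<tau> * wx k \<xi> * (a * a)" if "\<tau> < m" "\<xi> < n" for \<tau> \<xi> a
      by (intro mult_nonneg_nonneg zero_le_square less_imp_le wt_pos wx_pos that k)
    then show ?thesis
      unfolding ip_eq by (intro sum_mono sum_mono2) auto
  qed
  finally show ?thesis .
qed

lemma P_st_mult_inv_mat:
  assumes k: "k \<in> {1..num_elems M}"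
  shows "P_st M k * inv_mat (P_st M k) = 1\<^sub>m (num_dofs M)"
    "inv_mat (P_st M k) \<in> carrier_mat (num_dofs M) (num_dofs M)"
proof -
  have "wt (i div n) * wx k (i mod n) \<noteq> 0" if "i < num_dofs M" for i
    using that wt_pos[of "i div n"] wx_pos[OF k, of "i mod n"]
    by (simp add: num_dofs_eq less_mult_imp_div_less)
  from mat_diag_mult_inv_mat[of "num_dofs M" "\<lambda>i. wt (i div n) * wx k (i mod n)", OF this]
  show "P_st M k * inv_mat (P_st M k) = 1\<^sub>m (num_dofs M)"
    "inv_mat (P_st M k) \<in> carrier_mat (num_dofs M) (num_dofs M)"
    by (simp_all add: P_st_eq)
qed

text \<open>The inverse in the penalty cancels the norm matrix of \<open>ip\<close>, and
  \<open>R\<close> transposed moves over to the test vector. Leaving \<open>R\<close> and the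
  weights arbitrary covers boundary, initial and interface penalties alike.\<close>

lemma ip_sat:
  assumes k: "k \<in> {1..num_elems M}"
    and R: "R \<in> carrier_mat r (num_dofs M)"
    and v: "v \<in> carrier_vec (num_dofs M)" and y: "y \<in> carrier_vec r"
  shows "ip k v ((inv_mat (P_st M k) * R\<^sup>T * mat_diag r w) *\<^sub>v y) = wip r w (R *\<^sub>v v) y"
    "(inv_mat (P_st M k) * R\<^sup>T * mat_diag r w) *\<^sub>v y \<in> carrier_vec (num_dofs M)"
proof -
  note C = P_st_mult_inv_mat(2)[OF k]
  have RT: "R\<^sup>T \<in> carrier_mat (num_dofs M) r" using R by simp
  have W: "mat_diag r w *\<^sub>v y \<in> carrier_vec r" by (rule mult_mat_vec_carrier[OF mat_diag_dim y])
  let ?z = "R\<^sup>T *\<^sub>v (mat_diag r w *\<^sub>v y)"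
  have z: "?z \<in> carrier_vec (num_dofs M)" by (rule mult_mat_vec_carrier[OF RT W])
  have split: "(inv_mat (P_st M k) * R\<^sup>T * mat_diag r w) *\<^sub>v y = inv_mat (P_st M k) *\<^sub>v ?z"
    using assoc_mult_mat_vec[OF mult_carrier_mat[OF C RT] mat_diag_dim y]
      assoc_mult_mat_vec[OF C RT W] by simp
  show carrier: "(inv_mat (P_st M k) * R\<^sup>T * mat_diag r w) *\<^sub>v y \<in> carrier_vec (num_dofs M)"
    unfolding split by (rule mult_mat_vec_carrier[OF C z])
  have "ip k v ((inv_mat (P_st M k) * R\<^sup>T * mat_diag r w) *\<^sub>v y)
      = v \<bullet> (P_st M k *\<^sub>v (inv_mat (P_st M k) *\<^sub>v ?z))"
    using ip_scalar_prod[OF carrier] by (simp only: split)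
  also have "P_st M k *\<^sub>v (inv_mat (P_st M k) *\<^sub>v ?z) = ?z"
    using assoc_mult_mat_vec[OF operator_carriers(9) C z, of k] P_st_mult_inv_mat(1)[OF k] z by simp
  also have "v \<bullet> ?z = ?z \<bullet> v" by (rule comm_scalar_prod[OF v z])
  also have "\<dots> = (mat_diag r w *\<^sub>v y) \<bullet> (R *\<^sub>v v)"
    by (rule transpose_vec_mult_scalar[OF R v W])
  also have "\<dots> = (R *\<^sub>v v) \<bullet> (mat_diag r w *\<^sub>v y)"
    by (rule comm_scalar_prod[OF W mult_mat_vec_carrier[OF R v]])
  also have "\<dots> = wip r w (R *\<^sub>v v) y"
    by (rule scalar_prod_mat_diag[OF y])
  finally show "ip k v ((inv_mat (P_st M k) * R\<^sup>T * mat_diag r w) *\<^sub>v y) = wip r w (R *\<^sub>v v) y" .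
qed

text \<open>The two transposes combine to that of \<open>R * D_x M k\<close>, which reduces this to
  \<open>ip_sat\<close> with the derivative trace as restriction.\<close>

lemma ip_flux_sat:
  assumes k: "k \<in> {1..num_elems M}"
    and R: "R \<in> carrier_mat r (num_dofs M)"
    and v: "v \<in> carrier_vec (num_dofs M)" and y: "y \<in> carrier_vec r"
  shows "ip k v ((inv_mat (P_st M k) * (D_x M k)\<^sup>T * R\<^sup>T * mat_diag r w) *\<^sub>v y)
      = wip r w (R *\<^sub>v (D_x M k *\<^sub>v v)) y"
    "(inv_mat (P_st M k) * (D_x M k)\<^sup>T * R\<^sup>T * mat_diag r w) *\<^sub>v y \<in> carrier_vec (num_dofs M)"
proof -
  have RD: "R * D_x M k \<in> carrier_mat r (num_dofs M)"
    by (rule mult_carrier_mat[OF R operator_carriers(1)])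
  have "inv_mat (P_st M k) * (D_x M k)\<^sup>T * R\<^sup>T = inv_mat (P_st M k) * (R * D_x M k)\<^sup>T"
    using transpose_mult[OF R operator_carriers(1)[of k]]
      assoc_mult_mat[OF P_st_mult_inv_mat(2)[OF k], of "(D_x M k)\<^sup>T" "num_dofs M" "R\<^sup>T" r] R by simp
  then show "ip k v ((inv_mat (P_st M k) * (D_x M k)\<^sup>T * R\<^sup>T * mat_diag r w) *\<^sub>v y)
      = wip r w (R *\<^sub>v (D_x M k *\<^sub>v v)) y"
    "(inv_mat (P_st M k) * (D_x M k)\<^sup>T * R\<^sup>T * mat_diag r w) *\<^sub>v y \<in> carrier_vec (num_dofs M)"
    using ip_sat[OF k RD v y] assoc_mult_mat_vec[OF R operator_carriers(1) v] by simp_all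
qed

end

section \<open>Energy balance of a discrete solution\<close>

locale sbp_sat_solution = sbp_mesh +
  fixes c :: sat_coeffs and hv gv :: "real Matrix.vec" and qv u :: "nat \<Rightarrow> real Matrix.vec"
  assumes solves: "solves_scheme M c hv gv qv u"
    and data_carrier: "hv \<in> carrier_vec (num_dofs M)" "gv \<in> carrier_vec (num_dofs M)"
      "\<And>k. k \<in> {1..num_elems M} \<Longrightarrow> qv k \<in> carrier_vec (num_dofs M)"
begin

abbreviation UW where "UW k \<equiv> R_w M *\<^sub>v u k"
abbreviation UE where "UE k \<equiv> R_e M *\<^sub>v u k"
abbreviation US where "US k \<equiv> R_s M *\<^sub>v u k"
abbreviation UF where "UF k \<equiv> R_n M *\<^sub>v u k"
abbreviation DW where "DW k \<equiv> R_w M *\<^sub>v (D_x M k *\<^sub>v u k)"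
abbreviation DE where "DE k \<equiv> R_e M *\<^sub>v (D_x M k *\<^sub>v u k)"
abbreviation FW where "FW k \<equiv> diffusivity M k \<cdot>\<^sub>v DW k"
abbreviation FE where "FE k \<equiv> diffusivity M k \<cdot>\<^sub>v DE k"

lemma u_carrier [simp]:
  "k \<in> {1..num_elems M} \<Longrightarrow> u k \<in> carrier_vec (num_dofs M)"
  using solves by (simp add: solves_scheme_def)

lemma trace_carriers [simp]:
  assumes "k \<in> {1..num_elems M}"
  shows "UW k \<in> carrier_vec m" "UE k \<in> carrier_vec m" "US k \<in> carrier_vec n" "UF k \<in> carrier_vec n"
    "DW k \<in> carrier_vec m" "DE k \<in> carrier_vec m"
    "D_x M k *\<^sub>v u k \<in> carrier_vec (num_dofs M)"
    "D_x M k *\<^sub>v (D_x M k *\<^sub>v u k) \<in> carrier_vec (num_dofs M)"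
    "D_t M *\<^sub>v u k \<in> carrier_vec (num_dofs M)"
  using u_carrier[OF assms] by simp_all

lemma flux_eq:
  assumes "k \<in> {1..num_elems M}"
  shows "(R_w M * D_x M k) *\<^sub>v u k = DW k" "(R_e M * D_x M k) *\<^sub>v u k = DE k"
  using assoc_mult_mat_vec[OF operator_carriers(3) operator_carriers(1) u_carrier[OF assms]]
    assoc_mult_mat_vec[OF operator_carriers(4) operator_carriers(1) u_carrier[OF assms]] by simp_all

lemma ip_S_w:
  assumes k: "k \<in> {1..num_elems M}"
  shows "ip k (u k) (S_w M c hv u k)
      = (if k = 1 then sigma_w c * ipt (UW k) (UW k - R_w M *\<^sub>v hv) else 0)"
    "S_w M c hv u k \<in> carrier_vec (num_dofs M)"
proof -
  have y: "UW k - R_w M *\<^sub>v hv \<in> carrier_vec m"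
    using k data_carrier by simp
  note sat = ip_sat[OF k operator_carriers(3) u_carrier[OF k] y, of wt, folded Pt_bar_eq]
  show "ip k (u k) (S_w M c hv u k)
      = (if k = 1 then sigma_w c * ipt (UW k) (UW k - R_w M *\<^sub>v hv) else 0)"
    "S_w M c hv u k \<in> carrier_vec (num_dofs M)"
    using sat by (cases "k = 1"; simp add: S_w_def wip_right_simps)+
qed

lemma ip_S_e:
  assumes k: "k \<in> {1..num_elems M}"
  shows "ip k (u k) (S_e M c gv u k)
      = (if k = num_elems M then sigma_e c * ipt (UE k) (UE k - R_e M *\<^sub>v gv) else 0)"
    "S_e M c gv u k \<in> carrier_vec (num_dofs M)"
proof -
  have y: "UE k - R_e M *\<^sub>v gv \<in> carrier_vec m"
    using k data_carrier by simp
  note sat = ip_sat[OF k operator_carriers(4) u_carrier[OF k] y, of wt, folded Pt_bar_eq]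
  show "ip k (u k) (S_e M c gv u k)
      = (if k = num_elems M then sigma_e c * ipt (UE k) (UE k - R_e M *\<^sub>v gv) else 0)"
    "S_e M c gv u k \<in> carrier_vec (num_dofs M)"
    using sat by (cases "k = num_elems M"; simp add: S_e_def wip_right_simps)+
qed

lemma ip_S_0:
  assumes k: "k \<in> {1..num_elems M}"
  shows "ip k (u k) (S_0 M c qv u k) = sigma0 c * ipx k (US k) (US k - R_s M *\<^sub>v qv k)"
    "S_0 M c qv u k \<in> carrier_vec (num_dofs M)"
proof -
  have y: "US k - R_s M *\<^sub>v qv k \<in> carrier_vec n"
    using k data_carrier by simp
  note sat = ip_sat[OF k operator_carriers(5) u_carrier[OF k] y, of "wx k", folded Px_bar_eq]
  show "ip k (u k) (S_0 M c qv u k) = sigma0 c * ipx k (US k) (US k - R_s M *\<^sub>v qv k)"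
    "S_0 M c qv u k \<in> carrier_vec (num_dofs M)"
    using sat by (simp_all add: S_0_def wip_right_simps)
qed

text \<open>The left interface penalty after testing with \<open>u k\<close>. In the
  \<open>tau1\<close> term the transposed derivative has moved onto \<open>u k\<close>, which
  together with the factor \<open>diffusivity M k\<close> produces the flux
  \<open>FW k\<close>.\<close>

definition left_interface :: "nat \<Rightarrow> real" where
  "left_interface k = sigma1 c * ipt (UW k) (UW k - UE (k - 1))
    + sigma2 c * ipt (UW k) (FW k - FE (k - 1))
    + tau1 c * ipt (FW k) (UW k - UE (k - 1))"

definition right_interface :: "nat \<Rightarrow> real" where
  "right_interface k = sigma3 c * ipt (UE k) (UE k - UW (k + 1))
    + sigma4 c * ipt (UE k) (FE k - FW (k + 1))
    + tau2 c * ipt (FE k) (UE k - UW (k + 1))"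

lemma ip_S_iface_left:
  assumes k: "k \<in> {1..num_elems M}"
  shows "ip k (u k) (S_iface_left M c u k) = (if 2 \<le> k then left_interface k else 0)"
    "S_iface_left M c u k \<in> carrier_vec (num_dofs M)"
proof -
  have "ip k (u k) (S_iface_left M c u k) = (if 2 \<le> k then left_interface k else 0) \<and>
    S_iface_left M c u k \<in> carrier_vec (num_dofs M)"
  proof (cases "2 \<le> k")
    case True
    then have k': "k - 1 \<in> {1..num_elems M}" using k by auto
    have y1: "UW k - UE (k - 1) \<in> carrier_vec m" and y2: "FW k - FE (k - 1) \<in> carrier_vec m"
      using k k' by simp_all
    note sats = ip_sat[OF k operator_carriers(3) u_carrier[OF k] y1, of wt, folded Pt_bar_eq]
      ip_sat[OF k operator_carriers(3) u_carrier[OF k] y2, of wt, folded Pt_bar_eq]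
      ip_flux_sat[OF k operator_carriers(3) u_carrier[OF k] y1, of wt, folded Pt_bar_eq]
    show ?thesis
      using True k sats
      by (simp add: S_iface_left_def left_interface_def flux_eq[OF k] flux_eq[OF k']
          wip_right_simps wip_smult_left[OF trace_carriers(5)[OF k]] del: One_nat_def)
  qed (simp add: S_iface_left_def wip_zero_right)
  then show "ip k (u k) (S_iface_left M c u k) = (if 2 \<le> k then left_interface k else 0)"
    "S_iface_left M c u k \<in> carrier_vec (num_dofs M)" by blast+
qed

lemma ip_S_iface_right:
  assumes k: "k \<in> {1..num_elems M}"
  shows "ip k (u k) (S_iface_right M c u k) = (if k < num_elems M then right_interface k else 0)"
    "S_iface_right M c u k \<in> carrier_vec (num_dofs M)"
proof -
  have "ip k (u k) (S_iface_right M c u k) = (if k < num_elems M then right_interface k else 0) \<and>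
    S_iface_right M c u k \<in> carrier_vec (num_dofs M)"
  proof (cases "k < num_elems M")
    case True
    then have k': "k + 1 \<in> {1..num_elems M}" using k by auto
    have y1: "UE k - UW (k + 1) \<in> carrier_vec m" and y2: "FE k - FW (k + 1) \<in> carrier_vec m"
      using k k' trace_carriers[OF k'] by simp_all
    note sats = ip_sat[OF k operator_carriers(4) u_carrier[OF k] y1, of wt, folded Pt_bar_eq]
      ip_sat[OF k operator_carriers(4) u_carrier[OF k] y2, of wt, folded Pt_bar_eq]
      ip_flux_sat[OF k operator_carriers(4) u_carrier[OF k] y1, of wt, folded Pt_bar_eq]
    show ?thesis
      using True k sats
      by (simp add: S_iface_right_def right_interface_def flux_eq[OF k] flux_eq[OF k', simplified]
          wip_right_simps wip_smult_left[OF trace_carriers(6)[OF k]])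
  qed (simp add: S_iface_right_def wip_zero_right)
  then show "ip k (u k) (S_iface_right M c u k) = (if k < num_elems M then right_interface k else 0)"
    "S_iface_right M c u k \<in> carrier_vec (num_dofs M)" by blast+
qed

lemma element_energy:
  assumes k: "k \<in> {1..num_elems M}"
  shows "ipx k (UF k) (UF k) / 2 - ipx k (US k) (US k) / 2
      - (ipt (UE k) (FE k) - ipt (UW k) (FW k))
      + diffusivity M k * ip k (D_x M k *\<^sub>v u k) (D_x M k *\<^sub>v u k)
    = - ip k (u k) (S_w M c hv u k) - ip k (u k) (S_e M c gv u k) - ip k (u k) (S_0 M c qv u k)
      - ip k (u k) (S_iface_left M c u k) - ip k (u k) (S_iface_right M c u k)"
proof -
  let ?\<kappa> = "diffusivity M k" and ?D = "D_x M k" and ?u = "u k"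
  have sq: "?D ^\<^sub>m 2 = ?D * ?D"
    using operator_carriers(1)[of k] by (simp add: numeral_2_eq_2)
  have DD: "?D * ?D \<in> carrier_mat (num_dofs M) (num_dofs M)"
    by (rule mult_carrier_mat[OF operator_carriers(1,1)])
  have "(D_t M - ?\<kappa> \<cdot>\<^sub>m (?D ^\<^sub>m 2)) *\<^sub>v ?u = D_t M *\<^sub>v ?u - ?\<kappa> \<cdot>\<^sub>v (?D *\<^sub>v (?D *\<^sub>v ?u))"
    using minus_mult_distrib_mat_vec[OF operator_carriers(2) smult_carrier_mat[OF DD] u_carrier[OF k]]
      smult_mat_mult_vec[OF DD u_carrier[OF k]]
      assoc_mult_mat_vec[OF operator_carriers(1,1) u_carrier[OF k]] sq by simp
  moreover have "(D_t M - ?\<kappa> \<cdot>\<^sub>m (?D ^\<^sub>m 2)) *\<^sub>v ?u =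
      - S_w M c hv u k - S_e M c gv u k - S_0 M c qv u k - S_iface_left M c u k - S_iface_right M c u k"
    using solves k by (simp add: solves_scheme_def)
  ultimately have "ip k ?u (D_t M *\<^sub>v ?u - ?\<kappa> \<cdot>\<^sub>v (?D *\<^sub>v (?D *\<^sub>v ?u))) = ip k ?u
      (- S_w M c hv u k - S_e M c gv u k - S_0 M c qv u k - S_iface_left M c u k - S_iface_right M c u k)"
    by simp
  then have "ip k ?u (D_t M *\<^sub>v ?u) - ?\<kappa> * ip k ?u (?D *\<^sub>v (?D *\<^sub>v ?u))
    = - ip k (u k) (S_w M c hv u k) - ip k (u k) (S_e M c gv u k) - ip k (u k) (S_0 M c qv u k)
      - ip k (u k) (S_iface_left M c u k) - ip k (u k) (S_iface_right M c u k)"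
    using k by (simp add: wip_right_simps ip_S_w ip_S_e ip_S_0 ip_S_iface_left ip_S_iface_right
        del: One_nat_def)
  \<comment> \<open>With both arguments equal, the two terms of summation by parts coincide, which
    explains the halves.\<close>
  moreover have "ip k ?u (D_t M *\<^sub>v ?u) = ipx k (UF k) (UF k) / 2 - ipx k (US k) (US k) / 2"
    using time_summation_by_parts[OF u_carrier[OF k] u_carrier[OF k], of k]
    by (simp add: wip_commute[of _ _ "D_t M *\<^sub>v ?u"])
  moreover have "?\<kappa> * ip k ?u (?D *\<^sub>v (?D *\<^sub>v ?u)) =
      ipt (UE k) (FE k) - ipt (UW k) (FW k) - ?\<kappa> * ip k (?D *\<^sub>v ?u) (?D *\<^sub>v ?u)"
    using space_summation_by_parts[OF k u_carrier[OF k] trace_carriers(7)[OF k]] k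
    by (simp add: wip_right_simps flip: right_diff_distrib)
  ultimately show ?thesis by simp
qed

text \<open>With \<open>a\<close>, \<open>b\<close> the traces and \<open>f\<close>,
  \<open>g\<close> the fluxes from right and left, the coefficients of the products
  \<open>a f\<close>, \<open>a g\<close>, \<open>b f\<close>, \<open>b g\<close> are
  \<open>1 + s - (1 + s)\<close>, \<open>- s + s\<close>, \<open>(1 + s) - (1 + s)\<close> and
  \<open>-1 + (1 + s) - s\<close>. All vanish, so only the \<open>sigma3\<close> multiple of the
  squared jump remains.\<close>

lemma interface_dissipation:
  assumes k: "k \<in> {1..<num_elems M}"
    and sigma: "sigma1 c = sigma3 c" "sigma3 c \<ge> 0"
    and s: "sigma2 c = s" "sigma4 c = 1 + s" "tau1 c = - (1 + s)" "tau2 c = - s"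
  shows "(ipt (UW (Suc k)) (FW (Suc k)) + left_interface (Suc k))
    + (right_interface k - ipt (UE k) (FE k)) \<ge> 0"
proof -
  have k1: "k \<in> {1..num_elems M}" and k2: "Suc k \<in> {1..num_elems M}" using k by auto
  define a b f g where "a = UW (Suc k)" and "b = UE k" and "f = FW (Suc k)" and "g = FE k"
  have [simp]: "a \<in> carrier_vec m" "b \<in> carrier_vec m" "f \<in> carrier_vec m" "g \<in> carrier_vec m"
    using trace_carriers[OF k1] trace_carriers[OF k2] by (simp_all add: a_def b_def f_def g_def)
  have "ipt (a - b) (a - b) = ipt a a - 2 * ipt a b + ipt b b"
    using wip_diff_right[of b m wt "a - b" a] wip_diff_right[of b m wt a a] wip_diff_right[of b m wt b a]
    by (simp add: wip_commute[of m wt "a - b" a] wip_commute[of m wt "a - b" b] wip_commute[of m wt b a])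
  moreover have "left_interface (Suc k) = sigma3 c * ipt a (a - b) + s * ipt a (f - g) + (- 1 - s) * ipt f (a - b)"
    by (simp add: left_interface_def s sigma(1) a_def b_def f_def g_def)
  moreover have "right_interface k = sigma3 c * ipt b (b - a) + (1 + s) * ipt b (g - f) - s * ipt g (b - a)"
    by (simp add: right_interface_def s a_def b_def f_def g_def)
  ultimately have "(ipt a f + left_interface (Suc k)) + (right_interface k - ipt b g)
      = sigma3 c * ipt (a - b) (a - b)"
    by (simp add: wip_diff_right wip_commute[of m wt f a] wip_commute[of m wt f b]
        wip_commute[of m wt g a] wip_commute[of m wt g b] wip_commute[of m wt b a] ring_distribs)
  moreover have "ipt (a - b) (a - b) \<ge> 0"
    by (rule wip_nonneg) (simp add: wt_pos less_imp_le)
  ultimately show ?thesis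
    using sigma(2) by (simp add: a_def b_def f_def g_def)
qed

theorem energy_estimate:
  assumes K: "num_elems M \<ge> 1"
    and \<kappa>: "\<And>k. k \<in> {1..num_elems M} \<Longrightarrow> 0 < diffusivity M k \<and> diffusivity M k \<le> \<kappa>max"
    and sigma0: "sigma0 c > 1 / 2"
    and sigma_w: "sigma_w c \<ge> \<kappa>max / (2 * wx 1 0)"
    and sigma_e: "sigma_e c \<ge> \<kappa>max / (2 * wx (num_elems M) (x_degree M))"
    and sigma: "sigma1 c = sigma3 c" "sigma3 c \<ge> 0"
    and s: "sigma2 c = s" "sigma4 c = 1 + s" "tau1 c = - (1 + s)" "tau2 c = - s"
  shows "(\<Sum>k = 1..num_elems M. ipx k (UF k) (UF k))
    \<le> (sigma0 c)\<^sup>2 / (2 * sigma0 c - 1)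
        * (\<Sum>k = 1..num_elems M. ipx k (R_s M *\<^sub>v qv k) (R_s M *\<^sub>v qv k))
      + sigma_w c * ipt (R_w M *\<^sub>v hv) (R_w M *\<^sub>v hv)
      + sigma_e c * ipt (R_e M *\<^sub>v gv) (R_e M *\<^sub>v gv)"
proof -
  let ?K = "num_elems M" and ?C = "(sigma0 c)\<^sup>2 / (2 * sigma0 c - 1)"
  let ?q = "\<lambda>k. ipx k (R_s M *\<^sub>v qv k) (R_s M *\<^sub>v qv k)"
  let ?h = "ipt (R_w M *\<^sub>v hv) (R_w M *\<^sub>v hv)" and ?g = "ipt (R_e M *\<^sub>v gv) (R_e M *\<^sub>v gv)"
  \<comment> \<open>A face flux is booked with the interface penalty acting on the same face; on the
    two outer faces it is left to the boundary penalty instead.\<close>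
  define A where "A k = ipt (UW k) (FW k) + left_interface k" for k
  define B where "B k = right_interface k - ipt (UE k) (FE k)" for k
  have elem: "ipx k (UF k) (UF k) \<le> ?C * ?q k + (if k = 1 then sigma_w c * ?h else 0)
      + (if k = ?K then sigma_e c * ?g else 0)
      - 2 * ((if 2 \<le> k then A k else 0) + (if k < ?K then B k else 0))"
    if k: "k \<in> {1..?K}" for k
  proof -
    let ?\<kappa> = "diffusivity M k"
    have \<kappa>': "?\<kappa> > 0" "?\<kappa> \<le> \<kappa>max" using \<kappa>[OF k] by auto
    have px: "wx k 0 > 0" "wx k (x_degree M) > 0" using wx_pos[OF k] by simp_all
    have wt: "wt i \<ge> 0" if "i < m" for i using wt_pos[OF that] by simp
    have initial: "ipx k (US k) (US k) - 2 * sigma0 c * ipx k (US k) (US k - R_s M *\<^sub>v qv k) \<le> ?C * ?q k"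
      using wx_pos[OF k] data_carrier(3)[OF k]
      by (intro wip_initial_penalty_bound[OF sigma0]) (auto simp: less_imp_le)
    \<comment> \<open>The west reserve of the dissipation is spent on the boundary flux in the first
      element; elsewhere it only helps and is discarded by its sign. The factor 2 undoes the halves
      in \<open>element_energy\<close>.\<close>
    have west: "(if k = 1 then - 2 * (ipt (UW k) (FW k) + ?\<kappa> * (wx k 0 * ipt (DW k) (DW k))
        + sigma_w c * ipt (UW k) (UW k - R_w M *\<^sub>v hv)) else - 2 * (?\<kappa> * (wx k 0 * ipt (DW k) (DW k))))
        \<le> (if k = 1 then sigma_w c * ?h else 0)"
    proof (cases "k = 1")
      case True
      have "?\<kappa> / (2 * wx k 0) \<le> \<kappa>max / (2 * wx k 0)"
        using \<kappa>' px by (intro divide_right_mono) auto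
      then have "?\<kappa> / (2 * wx k 0) \<le> sigma_w c" using sigma_w True by simp
      from wip_boundary_penalty_bound[where h = "R_w M *\<^sub>v hv" and e = 1 and y = "UW k" and d = "DW k",
          OF \<kappa>'(1) px(1) this wt]
      show ?thesis using True data_carrier(1) k by (simp add: wip_smult_right)
    qed (use \<kappa>' px wt wip_nonneg[of m wt "DW k"] in simp)
    have east: "(if k = ?K then - 2 * (- ipt (UE k) (FE k) + ?\<kappa> * (wx k (x_degree M) * ipt (DE k) (DE k))
        + sigma_e c * ipt (UE k) (UE k - R_e M *\<^sub>v gv)) else - 2 * (?\<kappa> * (wx k (x_degree M) * ipt (DE k) (DE k))))
        \<le> (if k = ?K then sigma_e c * ?g else 0)"
    proof (cases "k = ?K")
      case True
      have "?\<kappa> / (2 * wx k (x_degree M)) \<le> \<kappa>max / (2 * wx k (x_degree M))"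
        using \<kappa>' px by (intro divide_right_mono) auto
      then have "?\<kappa> / (2 * wx k (x_degree M)) \<le> sigma_e c" using sigma_e True by simp
      from wip_boundary_penalty_bound[where h = "R_e M *\<^sub>v gv" and e = "-1" and y = "UE k" and d = "DE k",
          OF \<kappa>'(1) px(2) this wt]
      show ?thesis using True data_carrier(2) k by (simp add: wip_smult_right)
    qed (use \<kappa>' px wt wip_nonneg[of m wt "DE k"] in simp)
    have "?\<kappa> * (wx k 0 * ipt (DW k) (DW k) + wx k (x_degree M) * ipt (DE k) (DE k))
        \<le> ?\<kappa> * ip k (D_x M k *\<^sub>v u k) (D_x M k *\<^sub>v u k)"
      using ip_ge_boundary[OF k trace_carriers(7)[OF k]] \<kappa>' by (intro mult_left_mono) auto
    then have "?\<kappa> * (wx k 0 * ipt (DW k) (DW k)) + ?\<kappa> * (wx k (x_degree M) * ipt (DE k) (DE k))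
        \<le> ?\<kappa> * ip k (D_x M k *\<^sub>v u k) (D_x M k *\<^sub>v u k)"
      by (simp only: distrib_left)
    moreover have "\<not> 2 \<le> k \<longleftrightarrow> k = 1" "\<not> k < ?K \<longleftrightarrow> k = ?K" using k by auto
    ultimately show ?thesis
      using element_energy[OF k] initial west east
      unfolding ip_S_w[OF k] ip_S_e[OF k] ip_S_0[OF k] ip_S_iface_left[OF k] ip_S_iface_right[OF k]
        A_def B_def
      by (cases "k = 1"; cases "k = ?K") simp_all
  qed
  have "(\<Sum>k = 1..?K. ipx k (UF k) (UF k))
      \<le> (\<Sum>k = 1..?K. ?C * ?q k + (if k = 1 then sigma_w c * ?h else 0)
      + (if k = ?K then sigma_e c * ?g else 0)
      - 2 * ((if 2 \<le> k then A k else 0) + (if k < ?K then B k else 0)))"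
    by (intro sum_mono elem)
  also have "\<dots> = ?C * (\<Sum>k = 1..?K. ?q k) + sigma_w c * ?h + sigma_e c * ?g
      - 2 * (\<Sum>k = 1..<?K. A (Suc k) + B k)"
  proof -
    \<comment> \<open>Only linearity in the constant matters, so the fraction is replaced by an
      arbitrary \<open>C\<close>.\<close>
    have "(\<Sum>k = 1..?K. C * ?q k + (if k = 1 then sigma_w c * ?h else 0)
      + (if k = ?K then sigma_e c * ?g else 0)
      - 2 * ((if 2 \<le> k then A k else 0) + (if k < ?K then B k else 0)))
      = C * (\<Sum>k = 1..?K. ?q k) + sigma_w c * ?h + sigma_e c * ?g
      - 2 * (\<Sum>k = 1..<?K. A (Suc k) + B k)" for C
      using K interface_sum[OF K, of A B]
      by (simp add: sum_subtractf sum.distrib flip: sum_distrib_left)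
    then show ?thesis .
  qed
  also have "\<dots> \<le> ?C * (\<Sum>k = 1..?K. ?q k) + sigma_w c * ?h + sigma_e c * ?g"
    using sum_nonneg[of "{1..<?K}" "\<lambda>k. A (Suc k) + B k"] interface_dissipation[OF _ sigma s]
    by (simp add: A_def B_def)
  finally show ?thesis .
qed

end

theorem theorem2:
  fixes M :: mesh and c :: sat_coeffs
    and a b \<kappa>min \<kappa>max p s :: real
    and \<rho> :: "nat \<Rightarrow> real"
    and h g q :: "real \<Rightarrow> real"
    and hv gv :: "real Matrix.vec"
    and qv u :: "nat \<Rightarrow> real Matrix.vec"
  assumes "a < b" and "final_time M > 0"
    and "num_elems M \<ge> 1" and "x_degree M \<ge> 1" and "t_degree M \<ge> 1"
    and "left_end M 1 = a" and "right_end M (num_elems M) = b"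
    and "\<forall>k\<in>{1..num_elems M}. left_end M k < right_end M k"
    and "\<forall>k\<in>{1..<num_elems M}. right_end M k = left_end M (k + 1)"
    and "0 < \<kappa>min" and "\<kappa>min \<le> \<kappa>max" and "p \<ge> 1"
    and "\<forall>k\<in>{1..num_elems M}. 0 \<le> \<rho> k \<and> \<rho> k \<le> 1"
    and "\<forall>k\<in>{1..num_elems M}. diffusivity M k = kappa_of \<kappa>min \<kappa>max p (\<rho> k)"
    and "hv = grid_vec M 1 (\<lambda>x t. h t)"
    and "gv = grid_vec M (num_elems M) (\<lambda>x t. g t)"
    and "\<forall>k\<in>{1..num_elems M}. qv k = grid_vec M k (\<lambda>x t. q x)"
    and "solves_scheme M c hv gv qv u"
    and "sigma0 c > 1 / 2"
    and "sigma_w c \<ge> \<kappa>max / (2 * (e_w M \<bullet> (Px_bar M 1 *\<^sub>v e_w M)))"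
    and "sigma_e c \<ge> \<kappa>max / (2 * (e_e M \<bullet> (Px_bar M (num_elems M) *\<^sub>v e_e M)))"
    and "sigma1 c = sigma3 c" and "sigma3 c \<ge> 0"
    and "s > 0"
    and "sigma2 c = s" and "sigma4 c = 1 + s"
    and "tau1 c = - (1 + s)" and "tau2 c = - s"
  shows "(\<Sum>k = 1..num_elems M. weighted_norm_sq (Px_bar M k) (R_n M *\<^sub>v u k))
    \<le> (sigma0 c)\<^sup>2 / (2 * sigma0 c - 1)
        * (\<Sum>k = 1..num_elems M. weighted_norm_sq (Px_bar M k) (R_s M *\<^sub>v qv k))
      + sigma_w c * weighted_norm_sq (Pt_bar M) (R_w M *\<^sub>v hv)
      + sigma_e c * weighted_norm_sq (Pt_bar M) (R_e M *\<^sub>v gv)"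
proof -
  interpret sbp_sat_solution M c hv gv qv u
  proof
    show "hv \<in> carrier_vec (num_dofs M)" "gv \<in> carrier_vec (num_dofs M)"
      using assms(15,16) by (simp_all add: grid_vec_def)
    show "qv k \<in> carrier_vec (num_dofs M)" if "k \<in> {1..num_elems M}" for k
      using assms(17) that by (simp add: grid_vec_def)
  qed (use assms in auto)
  have norm_x: "weighted_norm_sq (Px_bar M k) y = ipx k y y" if "y \<in> carrier_vec n" for k y
    using scalar_prod_mat_diag[OF that] by (simp add: weighted_norm_sq_def Px_bar_eq)
  have norm_t: "weighted_norm_sq (Pt_bar M) y = ipt y y" if "y \<in> carrier_vec m" for y
    using scalar_prod_mat_diag[OF that] by (simp add: weighted_norm_sq_def Pt_bar_eq)
  have corner: "e_w M \<bullet> (Px_bar M k *\<^sub>v e_w M) = wx k 0"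
    "e_e M \<bullet> (Px_bar M k *\<^sub>v e_e M) = wx k (x_degree M)" for k
    using norm_x[OF e_carriers(1), of k] norm_x[OF e_carriers(2), of k]
    by (simp_all add: weighted_norm_sq_def e_w_def e_e_def wip_unit_vec)
  have \<kappa>: "0 < diffusivity M k \<and> diffusivity M k \<le> \<kappa>max" if k: "k \<in> {1..num_elems M}" for k
  proof -
    have "0 \<le> \<rho> k powr p" "\<rho> k powr p \<le> 1"
      using assms(12,13) k by (auto intro: powr_le1)
    then have "0 \<le> (\<kappa>max - \<kappa>min) * \<rho> k powr p" "(\<kappa>max - \<kappa>min) * \<rho> k powr p \<le> \<kappa>max - \<kappa>min"
      using assms(11) by (auto intro: mult_left_le)
    then show ?thesis using assms(10,14) k by (simp add: kappa_of_def)
  qed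
  have "(\<Sum>k = 1..num_elems M. weighted_norm_sq (Px_bar M k) (R_n M *\<^sub>v u k))
      = (\<Sum>k = 1..num_elems M. ipx k (UF k) (UF k))"
    by (intro sum.cong) (auto simp: norm_x)
  moreover have "(\<Sum>k = 1..num_elems M. weighted_norm_sq (Px_bar M k) (R_s M *\<^sub>v qv k))
      = (\<Sum>k = 1..num_elems M. ipx k (R_s M *\<^sub>v qv k) (R_s M *\<^sub>v qv k))"
    by (intro sum.cong) (auto simp: norm_x data_carrier)
  ultimately show ?thesis
    using energy_estimate[OF assms(3) \<kappa> assms(19) assms(20,21)[unfolded corner] assms(22,23,25-28)]
    by (simp add: norm_t data_carrier)
qed

end
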